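(* Let $d\ge2$ and $f\in H^2(\mathcal{B})$. For every $q$ with $0<q<1$ the following (weak) maximum principle holds: $$|f(\zeta\theta)|\le(1-q)^{-d}\,\|f\|_{H^2(\mathcal{B})}\qquad\text{for all }|\zeta|\le q,\ \theta\in\mathbb{S}^{d-1}.$$ More generally, there is a constant $C_1>0$ independent of $\alpha$ (and of $f$ and $q$) such that for every mixed derivative $D^\alpha=D^\alpha_{\zeta,\theta}$ of order $|\alpha|\ge1$ with respect to the variables $\zeta$ and $\theta$, $$|D^\alpha f(\zeta\theta)|\le C_1\,(1-q)^{-d-|\alpha|}\left[\frac d2\Big(\frac d2+1\Big)\cdots\Big(\frac d2+|\alpha|\Big)\right]|\alpha|\,\|f\|_{H^2(\mathcal{B})}\qquad\text{for all }|\zeta|\le q,\ \theta\in\mathbb{S}^{d-1}.$$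
   Context: $\mathbb{D}=\{z\in\mathbb{C}:|z|<1\}$. $\mathbb{S}^{d-1}$ is the unit sphere of $\mathbb{R}^d$ with the rotation-invariant measure $d\theta$ normalized to total mass $1$. $\mathcal{H}_k(\mathbb{R}^d)$ is the space of harmonic homogeneous polynomials of degree $k$, $a_k=\dim\mathcal{H}_k(\mathbb{R}^d)$, and $Y_{k,\ell}$ ($\ell=1,\dots,a_k$) is a fixed basis of $\mathcal{H}_k(\mathbb{R}^d)$ orthonormal for $\int_{\mathbb{S}^{d-1}}f\overline g\,d\theta$. $\mathcal{B}=\{z\theta:z\in\mathbb{D},\theta\in\mathbb{S}^{d-1}\}=\mathbb{D}\times\mathbb{S}^{d-1}/\mathbb{Z}_2$ (with $(z,\theta)$ and $(-z,-\theta)$ identified) is the unit ball of the Klein-Dirac quadric; $f(z\theta)=f(z,\theta)$. The polyharmonic Hardy space $H^2(\mathcal{B})$ consists of the functions $f(z,\theta)=\sum_{k=0}^{\infty}\sum_{\ell=1}^{a_k}\sum_{j=0}^{\infty}f_{k,\ell;j}z^{k+2j}Y_{k,\ell}(\theta)$ on $|z|<1$, $\theta\in\mathbb{S}^{d-1}$, with $\|f\|^2_{H^2(\mathcal{B})}=\sum_{k,\ell,j}|f_{k,\ell;j}|^2<\infty$. A mixed derivative $D^\alpha_{\zeta,\theta}$ of order $|\alpha|$ is a composition of $|\alpha|$ first-order operators, each being either $\partial/\partial\zeta$ (complex derivative) or one of the rotational derivatives $\theta_i\partial_{\theta_j}-\theta_j\partial_{\theta_i}$ ($1\le i<j\le d$)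 on $\mathbb{S}^{d-1}$, applied to the function $(\zeta,\theta)\mapsto f(\zeta\theta)$. *)

theory Defs
  imports "HOL-Analysis.Analysis" "HOL-Library.Function_Algebras"
begin

text \<open>
  The ambient space is \<open>real ^ 'd\<close> with \<open>d = CARD('d)\<close>; a linear order on the finite index
  type is used only to single out the pairs \<open>i < j\<close>.
\<close>

subsection \<open>The rotation-invariant probability measure on the unit sphere\<close>

definition normalized_sphere_measure :: "(real ^ 'd) measure \<Rightarrow> bool" where
  "normalized_sphere_measure \<sigma> \<longleftrightarrow>
     sets \<sigma> = sets (restrict_space borel (sphere 0 1)) \<and>
     emeasure \<sigma> (sphere 0 1) = 1 \<and>
     (\<forall>Q. rotation_matrix Q \<longrightarrow> distr \<sigma> \<sigma> (\<lambda>x. Q *v x) = \<sigma>)"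

text \<open>For \<open>d \<ge> 2\<close> this determines the measure; it always exists, as the radial projection of the
  uniform distribution on the punctured unit ball. (The class \<open>wellorder\<close> is inherited from
  \<open>measure_orthogonal_image\<close>.)\<close>

lemma normalized_sphere_measure_exists:
  "\<exists>\<sigma> :: (real ^ 'd::{finite,wellorder}) measure. normalized_sphere_measure \<sigma>"
proof -
  define U where "U = ball (0 :: real ^ 'd::{finite,wellorder}) 1 - {0}"
  define p where "p = (\<lambda>x :: real ^ 'd::{finite,wellorder}. if x = 0 then axis undefined 1 else sgn x)"
  define S where "S = restrict_space borel (sphere (0 :: real ^ 'd::{finite,wellorder}) 1)"
  define \<mu> where "\<mu> = uniform_measure lborel U"
  define \<sigma> where "\<sigma> = distr \<mu> S p"
  have Us: "U \<in> sets borel" by (simp add: U_def)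
  have oU: "open U" by (simp add: U_def open_delete)
  have "axis undefined (1/2) \<in> U"
    by (auto simp: U_def norm_axis_1 axis_eq_0_iff norm_eq_sqrt_inner inner_axis_axis real_sqrt_mult[symmetric])
  then have "emeasure lborel U \<noteq> 0"
    using oU open_not_negligible[of U] by (auto simp: negligible_iff_null_sets null_sets_def)
  moreover have fin: "emeasure lborel U < \<infinity>"
    by (rule le_less_trans[OF emeasure_mono emeasure_lborel_ball_finite]) (auto simp: U_def)
  ultimately have prob: "emeasure \<mu> UNIV = 1"
    using Us by (simp add: \<mu>_def emeasure_uniform_measure ennreal_divide_self)
  have pm: "p \<in> measurable borel S"
    unfolding S_def p_def
    by (rule measurable_restrict_space2) (auto simp: norm_sgn norm_axis_1)
  have pm': "p \<in> measurable \<mu> S"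
    using pm by (simp add: \<mu>_def cong: measurable_cong_sets)
  have sp: "space S = sphere 0 1" by (simp add: S_def space_restrict_space)
  have "emeasure \<sigma> (sphere 0 1) = 1"
  proof -
    have "sphere 0 1 \<in> sets S" using sets.top[of S] sp by simp
    moreover have "p -` sphere 0 1 = UNIV" by (auto simp: p_def norm_sgn norm_axis_1)
    moreover have "space \<mu> = UNIV" by (simp add: \<mu>_def)
    ultimately show ?thesis using prob pm' by (simp add: \<sigma>_def emeasure_distr)
  qed
  moreover have "distr \<sigma> \<sigma> (\<lambda>x. Q *v x) = \<sigma>" if Q: "rotation_matrix Q" for Q
  proof (rule measure_eqI)
    have ot: "orthogonal_transformation (\<lambda>x. Q *v x)"
      using Q orthogonal_transformation_matrix
      by (metis matrix_of_matrix_vector_mul matrix_vector_mul_linear rotation_matrix_def)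
    have nQ: "norm (Q *v x) = norm x" for x
      using ot orthogonal_transformation_norm by blast
    have Qm: "(\<lambda>x. Q *v x) \<in> measurable borel borel"
      by (intro borel_measurable_continuous_onI linear_continuous_on) (simp add: linear_linear)
    have QS: "(\<lambda>x. Q *v x) \<in> measurable S S"
      unfolding S_def
      by (rule measurable_restrict_space3[OF Qm]) (auto simp: nQ)
    have QS': "(\<lambda>x. Q *v x) \<in> measurable \<sigma> \<sigma>"
      using QS by (simp add: \<sigma>_def cong: measurable_cong_sets)
    have inj: "inj (\<lambda>x. Q *v x)" using ot orthogonal_transformation_inj by blast
    have surj: "surj (\<lambda>x. Q *v x)" using ot orthogonal_transformation_surj by blast
    show "emeasure (distr \<sigma> \<sigma> (\<lambda>x. Q *v x)) A = emeasure \<sigma> A"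
      if A: "A \<in> sets (distr \<sigma> \<sigma> (\<lambda>x. Q *v x))" for A
    proof -
      have AS: "A \<in> sets S" using A by (simp add: \<sigma>_def)
      define B where "B = (\<lambda>x. Q *v x) -` A \<inter> space S"
      have BS: "B \<in> sets S" unfolding B_def by (rule measurable_sets[OF QS AS])
      define VA where "VA = U \<inter> p -` A"
      define VB where "VB = U \<inter> p -` B"
      have pre: "p -` X \<in> sets borel" if "X \<in> sets S" for X
        using measurable_sets[OF pm that] by simp
      have VAs: "VA \<in> sets borel" and VBs: "VB \<in> sets borel"
        using pre AS BS Us by (auto simp: VA_def VB_def)
      have em: "emeasure \<sigma> X = emeasure lborel (U \<inter> p -` X) / emeasure lborel U" if "X \<in> sets S" for X
        using that pre[OF that] Us pm'
        by (simp add: \<sigma>_def emeasure_distr \<mu>_def emeasure_uniform_measure)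
      have eq: "x \<in> VB \<longleftrightarrow> Q *v x \<in> VA" for x
      proof (cases "x = 0")
        case True
        then show ?thesis by (simp add: VA_def VB_def U_def)
      next
        case False
        then have "Q *v x \<noteq> 0" using nQ[of x] by auto
        moreover have "Q *v sgn x = sgn (Q *v x)"
          by (simp add: sgn_div_norm nQ matrix_vector_mult_scaleR)
        ultimately show ?thesis using False
          by (auto simp: VA_def VB_def U_def B_def p_def nQ sp norm_sgn)
      qed
      have img: "(\<lambda>x. Q *v x) ` VB = VA"
        using eq surj by (auto simp: image_iff) (metis surjD)
      have finV: "emeasure lborel V < \<infinity>" if "V \<subseteq> U" for V
        by (rule le_less_trans[OF emeasure_mono fin]) (use that Us in auto)
      have lmb: "V \<in> lmeasurable" if "V \<subseteq> U" "V \<in> sets borel" for V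
        using finV[OF that(1)] that(2) by (simp add: fmeasurable_def)
      have VBl: "VB \<in> lmeasurable" by (rule lmb[OF _ VBs]) (simp add: VB_def)
      have "measure lebesgue VA = measure lebesgue VB"
        using measure_orthogonal_image[OF ot VBl] img by simp
      then have "measure lborel VA = measure lborel VB"
        using VAs VBs by simp
      moreover have "emeasure lborel VA = ennreal (measure lborel VA)"
        using finV[of VA] by (intro emeasure_eq_ennreal_measure) (auto simp: VA_def)
      moreover have "emeasure lborel VB = ennreal (measure lborel VB)"
        using finV[of VB] by (intro emeasure_eq_ennreal_measure) (auto simp: VB_def)
      ultimately have "emeasure \<sigma> A = emeasure \<sigma> B"
        using em[OF AS] em[OF BS] by (simp add: VA_def VB_def)
      moreover have "emeasure (distr \<sigma> \<sigma> (\<lambda>x. Q *v x)) A = emeasure \<sigma> B"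
        using AS QS' by (simp add: emeasure_distr B_def \<sigma>_def)
      ultimately show ?thesis by simp
    qed
  qed (simp add: \<sigma>_def)
  moreover have "sets \<sigma> = sets (restrict_space borel (sphere 0 1))"
    by (simp add: \<sigma>_def S_def)
  ultimately show ?thesis unfolding normalized_sphere_measure_def by blast
qed


subsection \<open>Harmonic homogeneous polynomials\<close>

definition partial_deriv :: "'d::finite \<Rightarrow> (real ^ 'd \<Rightarrow> complex) \<Rightarrow> real ^ 'd \<Rightarrow> complex" where
  "partial_deriv i g x = vector_derivative (\<lambda>t. g (x + t *\<^sub>R axis i 1)) (at 0)"

definition laplacian :: "(real ^ 'd \<Rightarrow> complex) \<Rightarrow> real ^ 'd \<Rightarrow> complex" where
  "laplacian g x = (\<Sum>i\<in>UNIV. partial_deriv i (partial_deriv i g) x)"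

definition harmonic_polys :: "nat \<Rightarrow> (real ^ 'd \<Rightarrow> complex) set" where
  "harmonic_polys k =
     {p. polynomial_function p \<and>
         (\<forall>c x. p (c *\<^sub>R x) = of_real c ^ k * p x) \<and>
         (\<forall>x. laplacian p x = 0)}"

interpretation cfun: vector_space "\<lambda>(c::complex) (f :: 'a \<Rightarrow> complex) x. c * f x"
  by unfold_locales (auto simp: fun_eq_iff algebra_simps)

definition harmonic_dim :: "'d::finite itself \<Rightarrow> nat \<Rightarrow> nat" where
  "harmonic_dim _ k = cfun.dim (harmonic_polys k :: (real ^ 'd \<Rightarrow> complex) set)"

definition orthonormal_harmonic_basis ::
    "(real ^ 'd) measure \<Rightarrow> (nat \<Rightarrow> nat \<Rightarrow> real ^ 'd \<Rightarrow> complex) \<Rightarrow> bool" where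
  "orthonormal_harmonic_basis \<sigma> Y \<longleftrightarrow>
     (\<forall>k. inj_on (Y k) {1..harmonic_dim TYPE('d) k} \<and>
          cfun.independent (Y k ` {1..harmonic_dim TYPE('d) k}) \<and>
          cfun.span (Y k ` {1..harmonic_dim TYPE('d) k}) = harmonic_polys k \<and>
          (\<forall>l\<in>{1..harmonic_dim TYPE('d) k}. \<forall>m\<in>{1..harmonic_dim TYPE('d) k}.
             (LINT \<theta>|\<sigma>. Y k l \<theta> * cnj (Y k m \<theta>)) = (if l = m then 1 else 0)))"


subsection \<open>The polyharmonic Hardy space\<close>

text \<open>The point \<open>z\<theta>\<close> of complex d-space. Functions on the ball of the Klein-Dirac quadric are
  represented by functions on \<open>complex ^ 'd\<close>, of which only the values at the points \<open>z\<theta>\<close> with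
  \<open>norm z < 1\<close> and \<open>\<theta>\<close> in the unit sphere are used.\<close>

definition klein_dirac_point :: "complex \<Rightarrow> real ^ 'd \<Rightarrow> complex ^ 'd" where
  "klein_dirac_point z \<theta> = (\<chi> i. z * of_real (\<theta> $ i))"

definition hardy_index :: "'d::finite itself \<Rightarrow> (nat \<times> nat \<times> nat) set" where
  "hardy_index _ = {(k, l, j). 1 \<le> l \<and> l \<le> harmonic_dim TYPE('d) k}"

definition hardy_coeffs ::
    "(nat \<Rightarrow> nat \<Rightarrow> real ^ 'd \<Rightarrow> complex) \<Rightarrow> (complex ^ 'd \<Rightarrow> complex)
       \<Rightarrow> (nat \<times> nat \<times> nat \<Rightarrow> complex) \<Rightarrow> bool" where
  "hardy_coeffs Y f c \<longleftrightarrow>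
     (\<lambda>n. (norm (c n))\<^sup>2) summable_on hardy_index TYPE('d) \<and>
     (\<forall>z \<theta>. norm z < 1 \<longrightarrow> norm \<theta> = 1 \<longrightarrow>
        ((\<lambda>(k, l, j). c (k, l, j) * z ^ (k + 2 * j) * Y k l \<theta>)
           has_sum f (klein_dirac_point z \<theta>)) (hardy_index TYPE('d)))"

definition hardy_space ::
    "(nat \<Rightarrow> nat \<Rightarrow> real ^ 'd \<Rightarrow> complex) \<Rightarrow> (complex ^ 'd \<Rightarrow> complex) set" where
  "hardy_space Y = {f. \<exists>c. hardy_coeffs Y f c}"

text \<open>The coefficients are uniquely determined by the function on \<open>hardy_index\<close> when \<open>Y\<close> is an
  orthonormal basis, so the choice below is immaterial.\<close>

definition hardy_norm ::
    "(nat \<Rightarrow> nat \<Rightarrow> real ^ 'd \<Rightarrow> complex) \<Rightarrow> (complex ^ 'd \<Rightarrow> complex) \<Rightarrow> real" where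
  "hardy_norm Y f =
     sqrt (\<Sum>\<^sub>\<infinity>n\<in>hardy_index TYPE('d). (norm ((SOME c. hardy_coeffs Y f c) n))\<^sup>2)"


subsection \<open>Mixed derivatives\<close>

definition zeta_deriv :: "(complex \<Rightarrow> real ^ 'd \<Rightarrow> complex) \<Rightarrow> complex \<Rightarrow> real ^ 'd \<Rightarrow> complex" where
  "zeta_deriv F \<zeta> \<theta> = deriv (\<lambda>w. F w \<theta>) \<zeta>"

text \<open>The operator \<open>\<theta>\<^sub>i \<partial>\<^sub>j - \<theta>\<^sub>j \<partial>\<^sub>i\<close> is tangential to the sphere, so its value there does not depend
  on how the function is extended off the sphere; the extension used is \<open>x \<mapsto> F \<zeta> (x / norm x)\<close>.\<close>

definition rot_deriv ::
    "'d::finite \<Rightarrow> 'd \<Rightarrow> (complex \<Rightarrow> real ^ 'd \<Rightarrow> complex) \<Rightarrow> complex \<Rightarrow> real ^ 'd \<Rightarrow> complex" where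
  "rot_deriv i j F \<zeta> \<theta> =
     of_real (\<theta> $ i) * partial_deriv j (\<lambda>x. F \<zeta> (sgn x)) \<theta>
       - of_real (\<theta> $ j) * partial_deriv i (\<lambda>x. F \<zeta> (sgn x)) \<theta>"

definition first_order_ops ::
    "((complex \<Rightarrow> real ^ 'd::{finite,linorder} \<Rightarrow> complex) \<Rightarrow>
      complex \<Rightarrow> real ^ 'd::{finite,linorder} \<Rightarrow> complex) set" where
  "first_order_ops = insert zeta_deriv {rot_deriv i j | i j. i < j}"

text \<open>A mixed derivative of order \<open>n\<close> is given by a list of length \<open>n\<close> over \<open>first_order_ops\<close>.\<close>

definition mixed_deriv ::
    "((complex \<Rightarrow> real ^ 'd \<Rightarrow> complex) \<Rightarrow> complex \<Rightarrow> real ^ 'd \<Rightarrow> complex) list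
       \<Rightarrow> (complex \<Rightarrow> real ^ 'd \<Rightarrow> complex) \<Rightarrow> complex \<Rightarrow> real ^ 'd \<Rightarrow> complex" where
  "mixed_deriv Ds = foldr (\<circ>) Ds id"

end

theory Submission
  imports Defs
begin

text \<open>
  Grouping the expansion of \<open>f\<close> by degree gives \<open>f (z\<theta>) = (\<Sum>m. z ^ m * G m \<theta>)\<close>, where \<open>G m\<close> is a sum of
  harmonic polynomials of degrees \<open>m, m - 2, \<dots>\<close>. A mixed derivative with \<open>a\<close> derivatives in \<open>\<zeta>\<close> and \<open>b\<close>
  rotational ones has the coefficients \<open>(p + 1) \<cdots> (p + a) * L (G (p + a))\<close>, where \<open>L\<close> is a product of
  \<open>b\<close> rotation fields. Each rotation field maps the harmonic polynomials of degree \<open>k\<close> to themselves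
  with L2-norm at most \<open>k\<close>, because along the rotations of a coordinate plane such a polynomial is a
  trigonometric polynomial of degree at most \<open>k\<close>; and \<open>\<bar>p \<theta>\<bar>\<^sup>2\<close> is at most \<open>a\<^sub>k\<close> times the square of the
  L2-norm of \<open>p\<close>, because \<open>\<Sum>l. \<bar>Y k l \<theta>\<bar>\<^sup>2\<close> is rotation invariant. With \<open>n = a + b\<close> and
  \<open>a\<^sub>k \<le> (k + 1) ^ (d - 1)\<close>, the coefficients are at most \<open>(p + 1) \<cdots> (p + n) * (p + n + 1) powr (d/2)\<close>
  times the norm of \<open>f\<close>; log-convexity of the Gamma function dominates this by the coefficients of
  \<open>Gamma (n + 1 + d/2) * (1 - q) powr (- n - 1 - d/2)\<close>, so \<open>C\<^sub>1 = Gamma (d/2)\<close> works.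
  For \<open>f\<close> itself the coefficients are at most \<open>(m + d - 1) choose m\<close> times the norm of \<open>f\<close>, and these
  binomials are the Taylor coefficients of \<open>(1 - q) powi (- d)\<close>.
\<close>

subsection \<open>Partial derivatives of polynomial functions\<close>

lemma partial_deriv_has_derivative:
  assumes "(g has_derivative g') (at x)"
  shows "partial_deriv i g x = g' (axis i 1)"
proof -
  interpret g': bounded_linear g' by (rule has_derivative_bounded_linear[OF assms])
  have "((\<lambda>t. g (x + t *\<^sub>R axis i 1)) has_derivative (\<lambda>t. g' (t *\<^sub>R axis i 1))) (at 0)"
    by (rule has_derivative_compose[of "\<lambda>t. x + t *\<^sub>R axis i 1" "\<lambda>t. t *\<^sub>R axis i 1" 0 UNIV g g'])
       (use assms in \<open>auto intro!: derivative_eq_intros\<close>)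
  then have "((\<lambda>t. g (x + t *\<^sub>R axis i 1)) has_vector_derivative g' (axis i 1)) (at 0)"
    by (simp add: has_vector_derivative_def g'.scaleR)
  then show ?thesis
    unfolding partial_deriv_def by (rule vector_derivative_at)
qed

lemma bounded_linear_expansion:
  fixes g :: "real ^ 'd \<Rightarrow> real"
  assumes "bounded_linear g"
  shows "g v = (\<Sum>i\<in>UNIV. v $ i * g (axis i 1))"
proof -
  interpret g: bounded_linear g by fact
  have "g v = g (\<Sum>i\<in>UNIV. v $ i *\<^sub>R axis i 1)"
    by (simp add: basis_expansion[of v, unfolded scalar_mult_eq_scaleR])
  also have "\<dots> = (\<Sum>i\<in>UNIV. v $ i * g (axis i 1))"
    by (simp add: g.sum g.scaleR)
  finally show ?thesis .
qed

text \<open>The induction carries polynomial coefficients for the derivative, so that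
  differentiation can be iterated; \<open>partial_deriv\<close> alone yields a value even where no
  derivative exists.\<close>

lemma real_polynomial_function_partials:
  fixes g :: "real ^ 'd \<Rightarrow> real"
  assumes "real_polynomial_function g"
  shows "\<exists>g'. (\<forall>i. real_polynomial_function (g' i)) \<and>
              (\<forall>x. (g has_derivative (\<lambda>v. \<Sum>i\<in>UNIV. v $ i * g' i x)) (at x))"
  using assms
proof induction
  case (linear g)
  have eq: "(\<lambda>v. \<Sum>i\<in>UNIV. v $ i * g (axis i 1)) = g"
    by (intro ext) (rule bounded_linear_expansion[OF linear, symmetric])
  have "(g has_derivative (\<lambda>v. \<Sum>i\<in>UNIV. v $ i * g (axis i 1))) (at x)" for x
    unfolding eq by (rule bounded_linear_imp_has_derivative) fact
  then show ?case
    by (intro exI[of _ "\<lambda>i x. g (axis i 1)"]) auto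
next
  case (const c)
  show ?case
    by (intro exI[of _ "\<lambda>i x. 0"]) auto
next
  case (add f g)
  then obtain f' g' where
    "\<forall>i. real_polynomial_function (f' i)" "\<forall>i. real_polynomial_function (g' i)"
    "\<forall>x. (f has_derivative (\<lambda>v. \<Sum>i\<in>UNIV. v $ i * f' i x)) (at x)"
    "\<forall>x. (g has_derivative (\<lambda>v. \<Sum>i\<in>UNIV. v $ i * g' i x)) (at x)" by blast
  then have "((\<lambda>x. f x + g x) has_derivative (\<lambda>v. \<Sum>i\<in>UNIV. v $ i * (f' i x + g' i x))) (at x)" for x
    unfolding distrib_left sum.distrib by (intro has_derivative_add) blast+
  with \<open>\<forall>i. real_polynomial_function (f' i)\<close> \<open>\<forall>i. real_polynomial_function (g' i)\<close>
  show ?case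
    by (intro exI[of _ "\<lambda>i x. f' i x + g' i x"]) auto
next
  case (mult f g)
  then obtain f' g' where d:
    "\<forall>i. real_polynomial_function (f' i)" "\<forall>i. real_polynomial_function (g' i)"
    "\<forall>x. (f has_derivative (\<lambda>v. \<Sum>i\<in>UNIV. v $ i * f' i x)) (at x)"
    "\<forall>x. (g has_derivative (\<lambda>v. \<Sum>i\<in>UNIV. v $ i * g' i x)) (at x)" by blast
  have "((\<lambda>x. f x * g x) has_derivative (\<lambda>v. \<Sum>i\<in>UNIV. v $ i * (f x * g' i x + f' i x * g x))) (at x)" for x
  proof -
    have "((\<lambda>x. f x * g x) has_derivative
      (\<lambda>v. f x * (\<Sum>i\<in>UNIV. v $ i * g' i x) + (\<Sum>i\<in>UNIV. v $ i * f' i x) * g x)) (at x)"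
      by (intro has_derivative_mult) (use d in blast)+
    then show ?thesis
      by (simp add: distrib_left sum.distrib sum_distrib_left sum_distrib_right mult_ac)
  qed
  moreover have "real_polynomial_function (\<lambda>x. f x * g' i x + f' i x * g x)" for i
    by (intro real_polynomial_function.intros(3,4)) (use d(1,2) mult.hyps in blast)+
  ultimately show ?case
    by (intro exI[of _ "\<lambda>i x. f x * g' i x + f' i x * g x"]) blast
qed

lemma polynomial_function_complex_iff:
  fixes p :: "'a::real_normed_vector \<Rightarrow> complex"
  shows "polynomial_function p \<longleftrightarrow>
    real_polynomial_function (\<lambda>x. Re (p x)) \<and> real_polynomial_function (\<lambda>x. Im (p x))"
  unfolding polynomial_function_iff_Basis_inner[of p] Basis_complex_def
  by (simp only: ball_simps complex_inner_1_right complex_inner_i_right simp_thms)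

lemma polynomial_function_partials:
  fixes p :: "real ^ 'd \<Rightarrow> complex"
  assumes "polynomial_function p"
  shows polynomial_function_partial_deriv: "polynomial_function (partial_deriv i p)"
    and polynomial_function_has_derivative:
      "(p has_derivative (\<lambda>v. \<Sum>i\<in>UNIV. v $ i *\<^sub>R partial_deriv i p x)) (at x)"
proof -
  obtain a where a: "\<And>i. real_polynomial_function (a i)"
    "\<And>x. ((\<lambda>x. Re (p x)) has_derivative (\<lambda>v. \<Sum>i\<in>UNIV. v $ i * a i x)) (at x)"
    using real_polynomial_function_partials[of "\<lambda>x. Re (p x)"] assms
    unfolding polynomial_function_complex_iff by blast
  obtain b where b: "\<And>i. real_polynomial_function (b i)"
    "\<And>x. ((\<lambda>x. Im (p x)) has_derivative (\<lambda>v. \<Sum>i\<in>UNIV. v $ i * b i x)) (at x)"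
    using real_polynomial_function_partials[of "\<lambda>x. Im (p x)"] assms
    unfolding polynomial_function_complex_iff by blast
  define p' where "p' = (\<lambda>i x. Complex (a i x) (b i x))"
  have D: "(p has_derivative (\<lambda>v. \<Sum>i\<in>UNIV. v $ i *\<^sub>R p' i x)) (at x)" for x
  proof -
    have "((\<lambda>x. of_real (Re (p x)) + \<i> * of_real (Im (p x))) has_derivative
      (\<lambda>v. of_real (\<Sum>i\<in>UNIV. v $ i * a i x) + \<i> * of_real (\<Sum>i\<in>UNIV. v $ i * b i x))) (at x)"
      by (intro derivative_intros has_derivative_of_real a b)
    then show ?thesis
      by (simp add: p'_def complex_eq[symmetric] Complex_eq sum_distrib_left sum.distrib[symmetric]
          scaleR_conv_of_real algebra_simps)
  qed
  have eq: "partial_deriv i p = p' i" for i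
  proof
    fix x
    have "partial_deriv i p x = (\<Sum>j\<in>UNIV. (axis i 1 :: real ^ 'd) $ j *\<^sub>R p' j x)"
      by (rule partial_deriv_has_derivative[OF D])
    also have "\<dots> = (\<Sum>j\<in>UNIV. if j = i then p' j x else 0)"
      by (intro sum.cong) (auto simp: axis_def)
    also have "\<dots> = p' i x" by simp
    finally show "partial_deriv i p x = p' i x" .
  qed
  show "polynomial_function (partial_deriv i p)"
    unfolding eq by (auto simp: polynomial_function_complex_iff p'_def a b)
  show "(p has_derivative (\<lambda>v. \<Sum>i\<in>UNIV. v $ i *\<^sub>R partial_deriv i p x)) (at x)"
    unfolding eq by (rule D)
qed

lemma partial_deriv_compose_matrix:
  fixes p :: "real ^ 'd \<Rightarrow> complex"
  assumes "polynomial_function p"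
  shows "partial_deriv i (\<lambda>x. p (Q *v x)) = (\<lambda>x. \<Sum>a\<in>UNIV. Q $ a $ i *\<^sub>R partial_deriv a p (Q *v x))"
proof
  fix x
  have "((\<lambda>x. p (Q *v x)) has_derivative
    (\<lambda>v. \<Sum>a\<in>UNIV. (Q *v v) $ a *\<^sub>R partial_deriv a p (Q *v x))) (at x)"
    by (rule has_derivative_compose[OF _ polynomial_function_has_derivative[OF assms]])
       (rule bounded_linear_imp_has_derivative, rule matrix_vector_mul_bounded_linear)
  from partial_deriv_has_derivative[OF this]
  show "partial_deriv i (\<lambda>x. p (Q *v x)) x = (\<Sum>a\<in>UNIV. Q $ a $ i *\<^sub>R partial_deriv a p (Q *v x))"
    by (simp add: matrix_vector_mul_component inner_axis)
qed

lemma partial_deriv_sum_scaleR: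
  fixes p :: "'a \<Rightarrow> real ^ 'd \<Rightarrow> complex"
  assumes "\<And>a. a \<in> A \<Longrightarrow> polynomial_function (p a)"
  shows "partial_deriv i (\<lambda>x. \<Sum>a\<in>A. c a *\<^sub>R p a x) = (\<lambda>x. \<Sum>a\<in>A. c a *\<^sub>R partial_deriv i (p a) x)"
proof
  fix x
  have "((\<lambda>x. \<Sum>a\<in>A. c a *\<^sub>R p a x) has_derivative
     (\<lambda>v. \<Sum>a\<in>A. c a *\<^sub>R (\<Sum>i\<in>UNIV. v $ i *\<^sub>R partial_deriv i (p a) x))) (at x)"
    by (intro derivative_intros polynomial_function_has_derivative assms)
  from partial_deriv_has_derivative[OF this, of i]
  show "partial_deriv i (\<lambda>x. \<Sum>a\<in>A. c a *\<^sub>R p a x) x = (\<Sum>a\<in>A. c a *\<^sub>R partial_deriv i (p a) x)"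
    using assms
    by (simp add: axis_def if_distrib[where f="\<lambda>r. r *\<^sub>R _"] cong: if_cong)
qed

lemma polynomial_function_compose_matrix:
  assumes "polynomial_function (p :: real ^ 'd \<Rightarrow> complex)"
  shows "polynomial_function (\<lambda>x. p (Q *v x))"
  using polynomial_function_compose[OF polynomial_function_bounded_linear[OF matrix_vector_mul_bounded_linear] assms]
  by (simp add: o_def)

text \<open>By the chain rule \<open>Q\<close> conjugates the Hessian, and conjugation by an
  orthogonal matrix preserves its trace.\<close>

lemma laplacian_compose_orthogonal:
  fixes p :: "real ^ 'd \<Rightarrow> complex"
  assumes p: "polynomial_function p" and Q: "orthogonal_matrix Q"
  shows "laplacian (\<lambda>x. p (Q *v x)) x = laplacian p (Q *v x)"
proof -
  have delta: "(\<Sum>i\<in>UNIV. Q $ a $ i * Q $ b $ i) = (if a = b then 1 else 0)" for a b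
  proof -
    have "(Q ** transpose Q) $ a $ b = mat 1 $ a $ b"
      using Q by (simp add: orthogonal_matrix_def)
    then show ?thesis by (simp add: matrix_matrix_mult_def transpose_def mat_def)
  qed
  have "laplacian (\<lambda>x. p (Q *v x)) x =
    (\<Sum>i\<in>UNIV. \<Sum>a\<in>UNIV. Q $ a $ i *\<^sub>R (\<Sum>b\<in>UNIV. Q $ b $ i *\<^sub>R partial_deriv b (partial_deriv a p) (Q *v x)))"
    by (simp add: laplacian_def partial_deriv_compose_matrix p partial_deriv_sum_scaleR
        polynomial_function_compose_matrix polynomial_function_partial_deriv)
  also have "\<dots> = (\<Sum>i\<in>UNIV. \<Sum>a\<in>UNIV. \<Sum>b\<in>UNIV. (Q $ a $ i * Q $ b $ i) *\<^sub>R partial_deriv b (partial_deriv a p) (Q *v x))"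
    by (simp add: scaleR_sum_right)
  also have "\<dots> = (\<Sum>a\<in>UNIV. \<Sum>i\<in>UNIV. \<Sum>b\<in>UNIV. (Q $ a $ i * Q $ b $ i) *\<^sub>R partial_deriv b (partial_deriv a p) (Q *v x))"
    by (rule sum.swap)
  also have "\<dots> = (\<Sum>a\<in>UNIV. \<Sum>b\<in>UNIV. (\<Sum>i\<in>UNIV. Q $ a $ i * Q $ b $ i) *\<^sub>R partial_deriv b (partial_deriv a p) (Q *v x))"
    unfolding scaleR_sum_left by (intro sum.cong refl sum.swap)
  also have "\<dots> = laplacian p (Q *v x)"
    by (simp add: delta laplacian_def if_distrib[where f="\<lambda>r. r *\<^sub>R _"] cong: if_cong)
  finally show ?thesis .
qed

lemma harmonic_polys_compose_orthogonal:
  assumes "p \<in> harmonic_polys k" "orthogonal_matrix Q"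
  shows "(\<lambda>x. p (Q *v x)) \<in> harmonic_polys k"
  using assms
  by (auto simp: harmonic_polys_def laplacian_compose_orthogonal polynomial_function_compose_matrix
      matrix_vector_mult_scaleR)


subsection \<open>Monomials and the dimension bound\<close>

lemma sum_fun_apply: "(\<Sum>i\<in>A. f i) x = (\<Sum>i\<in>A. f i x)"
  by (induction A rule: infinite_finite_induct) auto

definition monomial_fun :: "('d::finite \<Rightarrow> nat) \<Rightarrow> real ^ 'd \<Rightarrow> complex" where
  "monomial_fun \<alpha> x = (\<Prod>i\<in>UNIV. of_real (x $ i) ^ \<alpha> i)"

definition monomials :: "nat \<Rightarrow> (real ^ 'd \<Rightarrow> complex) set" where
  "monomials k = monomial_fun ` {\<alpha>. sum \<alpha> UNIV = k}"

text \<open>Enumerating the index type turns exponent functions into lists of length d with sum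
  \<open>k\<close>, which are counted by stars and bars.\<close>

lemma card_exponents:
  "finite {\<alpha> :: 'd::finite \<Rightarrow> nat. sum \<alpha> UNIV = k}"
  "card {\<alpha> :: 'd::finite \<Rightarrow> nat. sum \<alpha> UNIV = k} = (k + CARD('d) - 1) choose k"
proof -
  obtain xs :: "'d list" where xs: "set xs = UNIV" "distinct xs"
    using finite_distinct_list[OF finite[of UNIV]] by blast
  have len: "length xs = CARD('d)"
    using xs distinct_card by fastforce
  define A where "A = {l::nat list. length l = CARD('d) \<and> sum_list l = k}"
  have inj: "inj (\<lambda>\<alpha>::'d \<Rightarrow> nat. map \<alpha> xs)"
    by (rule injI) (use xs in \<open>auto simp: fun_eq_iff\<close>)
  have sub: "(\<lambda>\<alpha>. map \<alpha> xs) ` {\<alpha>. sum \<alpha> UNIV = k} = A"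
  proof (intro equalityI subsetI)
    fix l assume "l \<in> (\<lambda>\<alpha>. map \<alpha> xs) ` {\<alpha>. sum \<alpha> UNIV = k}"
    then show "l \<in> A"
      using xs len by (auto simp: A_def sum_list_distinct_conv_sum_set)
  next
    fix l assume l: "l \<in> A"
    define \<alpha> where "\<alpha> = (\<lambda>i. the (map_of (zip xs l) i))"
    have "map \<alpha> xs = l"
      using l len xs(2)
      by (intro nth_equalityI) (auto simp: A_def \<alpha>_def map_of_zip_nth)
    moreover have "sum \<alpha> UNIV = sum_list (map \<alpha> xs)"
      using xs by (simp add: sum_list_distinct_conv_sum_set)
    ultimately show "l \<in> (\<lambda>\<alpha>. map \<alpha> xs) ` {\<alpha>. sum \<alpha> UNIV = k}"
      using l by (auto simp: A_def intro!: image_eqI[of _ _ \<alpha>])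
  qed
  have "finite A"
  proof (rule finite_subset)
    show "A \<subseteq> {l. set l \<subseteq> {..k} \<and> length l = CARD('d)}"
      by (auto simp: A_def intro: member_le_sum_list)
    show "finite {l. set l \<subseteq> {..k} \<and> length l = CARD('d)}"
      by (rule finite_lists_length_eq) simp
  qed
  then show "finite {\<alpha> :: 'd \<Rightarrow> nat. sum \<alpha> UNIV = k}"
    using sub finite_imageD inj inj_on_subset subset_UNIV by metis
  have "card {\<alpha> :: 'd \<Rightarrow> nat. sum \<alpha> UNIV = k} = card A"
    unfolding sub[symmetric] using inj by (intro card_image[symmetric] inj_on_subset[OF inj]) auto
  then show "card {\<alpha> :: 'd \<Rightarrow> nat. sum \<alpha> UNIV = k} = (k + CARD('d) - 1) choose k"
    by (simp add: A_def card_length_sum_list)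
qed

lemma monomial_fun_mult:
  "(\<lambda>x. monomial_fun \<alpha> x * monomial_fun \<beta> x) = monomial_fun (\<lambda>i. \<alpha> i + \<beta> i)"
  by (simp add: monomial_fun_def fun_eq_iff power_add prod.distrib)

lemma span_range_monomial_fun_mult:
  assumes "f \<in> cfun.span (range monomial_fun)" "g \<in> cfun.span (range monomial_fun)"
  shows "(\<lambda>x. f x * g x) \<in> cfun.span (range monomial_fun)"
  using assms(1)
proof (induction rule: cfun.span_induct_alt)
  case base
  show ?case using cfun.span_zero[of "range monomial_fun"] by (simp add: zero_fun_def)
next
  case (step c m f)
  have "(\<lambda>x. m x * g x) \<in> cfun.span (range monomial_fun)"
    using assms(2)
  proof (induction rule: cfun.span_induct_alt)
    case base
    show ?case using cfun.span_zero[of "range monomial_fun"] by (simp add: zero_fun_def)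
  next
    case (step c' m' g)
    have "(\<lambda>x. m x * m' x) \<in> cfun.span (range monomial_fun)"
      using \<open>m \<in> range monomial_fun\<close> \<open>m' \<in> range monomial_fun\<close>
      by (auto simp: monomial_fun_mult intro: cfun.span_base)
    from cfun.span_add[OF cfun.span_scale[OF this, of c'] step.IH]
    show ?case by (simp add: plus_fun_def algebra_simps)
  qed
  from cfun.span_add[OF cfun.span_scale[OF this, of c] step.IH]
  show ?case by (simp add: plus_fun_def algebra_simps)
qed

lemma real_polynomial_function_span_monomials:
  fixes g :: "real ^ 'd \<Rightarrow> real"
  assumes "real_polynomial_function g"
  shows "(\<lambda>x. of_real (g x)) \<in> cfun.span (range monomial_fun)"
  using assms
proof induction
  case (linear g)
  have coord: "(\<lambda>x::real ^ 'd. of_real (x $ i)) \<in> cfun.span (range monomial_fun)" for i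
  proof -
    have "(\<lambda>x::real ^ 'd. of_real (x $ i)) = monomial_fun (\<lambda>j. if j = i then 1 else 0)"
      by (simp add: monomial_fun_def fun_eq_iff if_distrib[where f="\<lambda>n. _ ^ n"] cong: if_cong)
    then show ?thesis by (auto intro: cfun.span_base)
  qed
  have "(\<lambda>x. of_real (g x)) = (\<Sum>i\<in>UNIV. (\<lambda>x. complex_of_real (g (axis i 1)) * of_real (x $ i)))"
    by (subst bounded_linear_expansion[OF linear])
       (simp add: fun_eq_iff sum_fun_apply mult.commute)
  also have "\<dots> \<in> cfun.span (range monomial_fun)"
    by (intro cfun.span_sum cfun.span_scale coord)
  finally show ?case .
next
  case (const c)
  have "(\<lambda>x::real ^ 'd. 1) = monomial_fun (\<lambda>j. 0)"
    by (simp add: monomial_fun_def fun_eq_iff)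
  then have "(\<lambda>x::real ^ 'd. 1) \<in> cfun.span (range monomial_fun)"
    by (auto intro: cfun.span_base)
  from cfun.span_scale[OF this, of "of_real c"] show ?case by simp
next
  case (add f g)
  from cfun.span_add[OF add.IH] show ?case by (simp add: plus_fun_def)
next
  case (mult f g)
  from span_range_monomial_fun_mult[OF mult.IH] show ?case by simp
qed

lemma polynomial_function_span_monomials:
  fixes p :: "real ^ 'd \<Rightarrow> complex"
  assumes "polynomial_function p"
  shows "p \<in> cfun.span (range monomial_fun)"
proof -
  have "real_polynomial_function (\<lambda>x. Re (p x))" "real_polynomial_function (\<lambda>x. Im (p x))"
    using assms by (auto simp: polynomial_function_complex_iff)
  then have "(\<lambda>x. of_real (Re (p x))) + (\<lambda>x. \<i> * of_real (Im (p x))) \<in> cfun.span (range monomial_fun)"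
    by (intro cfun.span_add cfun.span_scale real_polynomial_function_span_monomials)
  then show ?thesis by (simp add: plus_fun_def complex_eq[symmetric])
qed

text \<open>Sorting the monomials by total degree yields the homogeneous components, one for each
  \<open>j\<close> up to some bound \<open>N\<close>.\<close>

lemma span_monomial_fun_decomp:
  fixes p :: "real ^ 'd \<Rightarrow> complex"
  assumes "p \<in> cfun.span (range monomial_fun)"
  shows "\<exists>N h. (\<forall>j. h j \<in> cfun.span (monomials j)) \<and> (\<forall>x. p x = (\<Sum>j\<le>N. h j x))"
  using assms
proof (induction rule: cfun.span_induct_alt)
  case base
  have "\<forall>j. (0 :: real ^ 'd \<Rightarrow> complex) \<in> cfun.span (monomials j)"
    by (blast intro: cfun.span_zero)
  then show ?case
    by (intro exI[of _ 0] exI[of _ "\<lambda>_. 0"]) (simp add: zero_fun_def)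
next
  case (step c m p)
  then obtain \<alpha> N h where m: "m = monomial_fun \<alpha>"
    and h: "\<And>j. h j \<in> cfun.span (monomials j)" "\<And>x. p x = (\<Sum>j\<le>N. h j x)" by auto
  define n where "n = sum \<alpha> UNIV"
  \<comment> \<open>The old \<open>h\<close> is unconstrained beyond \<open>N\<close> and may be
    nonzero there, so it is cut off before the summation range grows.\<close>
  define h' where "h' = (\<lambda>j. (if j \<le> N then h j else 0) + (if j = n then (\<lambda>x. c * m x) else 0))"
  have "m \<in> monomials n" by (auto simp: m monomials_def n_def)
  then have "h' j \<in> cfun.span (monomials j)" for j
    unfolding h'_def using h(1)
    by (auto intro!: cfun.span_add cfun.span_scale cfun.span_zero intro: cfun.span_base)
  moreover have "c * m x + p x = (\<Sum>j\<le>max n N. h' j x)" for x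
  proof -
    have "(\<Sum>j\<le>max n N. h' j x) =
      (\<Sum>j\<le>max n N. if j \<le> N then h j x else 0) + (\<Sum>j\<le>max n N. if j = n then c * m x else 0)"
      by (subst sum.distrib[symmetric], intro sum.cong) (auto simp: h'_def)
    also have "(\<Sum>j\<le>max n N. if j \<le> N then h j x else 0) = p x"
      unfolding h(2) by (rule sum.mono_neutral_cong_right) auto
    finally show ?thesis by simp
  qed
  ultimately show ?case by (intro exI[of _ "max n N"] exI[of _ h']) auto
qed

text \<open>For fixed \<open>x\<close> the value at \<open>t *\<^sub>R x\<close> is both t^k times
  \<open>p x\<close> and the sum of t^j times \<open>h j x\<close>. Comparing coefficients of t^k
  leaves only the component of degree \<open>k\<close>.\<close>

lemma homogeneous_polynomial_in_span:
  fixes p :: "real ^ 'd \<Rightarrow> complex"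
  assumes "polynomial_function p" and hom: "\<And>c x. p (c *\<^sub>R x) = of_real c ^ k * p x"
  shows "p \<in> cfun.span (monomials k)"
proof -
  obtain N h where h: "\<And>j. h j \<in> cfun.span (monomials j)" "\<And>x. p x = (\<Sum>j\<le>N. h j x)"
    using span_monomial_fun_decomp[OF polynomial_function_span_monomials[OF assms(1)]] by blast
  have hom_h: "f (c *\<^sub>R x) = of_real c ^ j * f x" if "f \<in> cfun.span (monomials j)"
    for f j c and x :: "real ^ 'd"
    using that
    by (induction rule: cfun.span_induct_alt)
       (auto simp: monomials_def monomial_fun_def power_mult_distrib prod.distrib
          power_sum[symmetric] algebra_simps)
  have "p x = (if k \<le> N then h k x else 0)" for x
  proof -
    \<comment> \<open>The difference of the two expressions as a polynomial in t. It vanishes at all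
      real t, hence has infinitely many roots and is zero.\<close>
    define P where "P = (\<Sum>j\<le>N. monom (h j x) j) - monom (p x) k"
    have "poly P (of_real t) = 0" for t :: real
    proof -
      have "p (t *\<^sub>R x) = (\<Sum>j\<le>N. of_real t ^ j * h j x)"
        unfolding h(2)[of "t *\<^sub>R x"] by (intro sum.cong refl hom_h h)
      then show ?thesis
        by (simp add: P_def poly_sum poly_monom hom mult.commute)
    qed
    then have "range complex_of_real \<subseteq> {z. poly P z = 0}" by auto
    moreover have "infinite (range complex_of_real)"
      by (simp add: finite_image_iff inj_of_real infinite_UNIV_char_0)
    ultimately have "P = 0"
      using poly_roots_finite finite_subset by blast
    then have "coeff P k = 0" by simp
    then show ?thesis by (simp add: P_def coeff_sum)
  qed
  then have "p = (if k \<le> N then h k else 0)" by (auto simp: fun_eq_iff)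
  then show ?thesis using h(1) by (auto intro: cfun.span_zero)
qed

lemma harmonic_polys_subset_span:
  "harmonic_polys k \<subseteq> cfun.span (monomials k :: (real ^ 'd \<Rightarrow> complex) set)"
  by (auto simp: harmonic_polys_def intro!: homogeneous_polynomial_in_span)

text \<open>Harmonic polynomials of degree \<open>k\<close> lie in the span of the monomials of
  degree \<open>k\<close>, so counting monomials is enough. The resulting growth of order k^(d-1) is
  coarse but sufficient.\<close>

lemma harmonic_dim_le: "harmonic_dim TYPE('d::finite) k \<le> (k + CARD('d) - 1) choose k"
proof -
  have "cfun.dim (harmonic_polys k :: (real ^ 'd \<Rightarrow> complex) set) \<le> card (monomials k :: (real ^ 'd \<Rightarrow> complex) set)"
    by (rule cfun.dim_le_card[OF harmonic_polys_subset_span]) (simp add: monomials_def card_exponents)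
  also have "\<dots> \<le> card {\<alpha> :: 'd \<Rightarrow> nat. sum \<alpha> UNIV = k}"
    unfolding monomials_def by (rule card_image_le[OF card_exponents(1)])
  finally show ?thesis by (simp add: harmonic_dim_def card_exponents)
qed


subsection \<open>Rotations of a coordinate plane\<close>

text \<open>The terms are powers of one N-th root of unity \<open>z\<close>, so the geometric sum
  vanishes unless \<open>z = 1\<close>. Exponents below \<open>N\<close> make \<open>z = 1\<close>
  equivalent to \<open>n = m\<close>.\<close>

lemma sum_roots_of_unity:
  assumes "n < N" "m < N"
  shows "(\<Sum>s<N. cis (2 * pi * real s / real N) ^ n * cnj (cis (2 * pi * real s / real N)) ^ m) =
    (if n = m then of_nat N else 0)"
proof -
  define w where "w = (\<lambda>n::nat. cis (2 * pi * real n / real N))"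
  have N: "N \<ge> 1" using assms by simp
  have w_exp: "w n = exp (2 * of_real pi * \<i> * of_nat n / of_nat N)" for n
    by (simp add: w_def cis_conv_exp mult_ac)
  have w_eq: "w n = w m \<longleftrightarrow> n = m"
    using complex_root_unity_eq[OF N, of n m] assms by (simp add: w_exp)
  have w_N: "w n ^ N = 1" for n
    using N by (simp add: w_def Complex.DeMoivre cis_multiple_2pi)
  \<comment> \<open>Base and exponent trade places here: the n-th power of the root with index s is
    the s-th power of the root with index n.\<close>
  define z where "z = w n * cnj (w m)"
  have "cnj (w m) * w m = 1" for m
    by (simp add: w_def cis_cnj cis_mult)
  then have z1: "z = 1 \<longleftrightarrow> n = m"
    unfolding w_eq[symmetric] z_def by (metis mult.assoc mult.commute mult.right_neutral)
  have zN: "z ^ N = 1" by (simp add: z_def power_mult_distrib w_N flip: complex_cnj_power)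
  have "cis (2 * pi * real s / real N) ^ n * cnj (cis (2 * pi * real s / real N)) ^ m = z ^ s" for s
    by (simp add: z_def w_def cis_cnj Complex.DeMoivre cis_mult algebra_simps)
  then have "(\<Sum>s<N. cis (2 * pi * real s / real N) ^ n * cnj (cis (2 * pi * real s / real N)) ^ m) = (\<Sum>s<N. z ^ s)"
    by simp
  also have "\<dots> = (if n = m then of_nat N else 0)"
    using z1 zN by (auto simp: geometric_sum)
  finally show ?thesis .
qed

text \<open>Expand the squares and apply the orthogonality of the characters of the cyclic group of
  order \<open>N\<close>. The identity is exact because there are as many nodes as
  coefficients.\<close>

lemma discrete_parseval:
  "(\<Sum>s<N. (cmod (\<Sum>n<N. a n * cis (2 * pi * real s / real N) ^ n))\<^sup>2) = real N * (\<Sum>n<N. (cmod (a n))\<^sup>2)"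
proof -
  define w where "w = (\<lambda>s::nat. cis (2 * pi * real s / real N))"
  have "complex_of_real (\<Sum>s<N. (cmod (\<Sum>n<N. a n * w s ^ n))\<^sup>2) =
    (\<Sum>s<N. (\<Sum>n<N. a n * w s ^ n) * cnj (\<Sum>m<N. a m * w s ^ m))"
    by (simp only: of_real_sum complex_norm_square)
  also have "\<dots> = (\<Sum>s<N. \<Sum>n<N. \<Sum>m<N. a n * cnj (a m) * (w s ^ n * cnj (w s) ^ m))"
    by (simp add: sum_product mult_ac)
  also have "\<dots> = (\<Sum>n<N. \<Sum>s<N. \<Sum>m<N. a n * cnj (a m) * (w s ^ n * cnj (w s) ^ m))"
    by (rule sum.swap)
  also have "\<dots> = (\<Sum>n<N. \<Sum>m<N. a n * cnj (a m) * (\<Sum>s<N. w s ^ n * cnj (w s) ^ m))"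
    unfolding sum_distrib_left by (intro sum.cong refl sum.swap)
  also have "\<dots> = (\<Sum>n<N. \<Sum>m<N. if n = m then a n * cnj (a m) * of_nat N else 0)"
    by (intro sum.cong refl) (auto simp: w_def sum_roots_of_unity simp del: cis_cnj)
  also have "\<dots> = (\<Sum>n<N. a n * cnj (a n) * of_nat N)"
    by (intro sum.cong refl) (simp add: sum.delta)
  also have "\<dots> = of_real (real N * (\<Sum>n<N. (cmod (a n))\<^sup>2))"
    by (simp add: sum_distrib_left mult.commute complex_norm_square del: of_real_power)
  finally show ?thesis unfolding w_def of_real_eq_iff .
qed

text \<open>Rotation by \<open>t\<close> from the \<open>i\<close>-axis towards the
  \<open>j\<close>-axis, fixing the other coordinates. The formula describes a rotation only for
  \<open>i \<noteq> j\<close>.\<close>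

definition plane_rot :: "'d::finite \<Rightarrow> 'd \<Rightarrow> real \<Rightarrow> real ^ 'd ^ 'd" where
  "plane_rot i j t = (\<chi> a b.
     if a = i then (if b = i then cos t else if b = j then - sin t else 0)
     else if a = j then (if b = i then sin t else if b = j then cos t else 0)
     else if a = b then 1 else 0)"

lemma plane_rot_mult:
  assumes "i \<noteq> j"
  shows "(plane_rot i j t *v x) $ a =
     (if a = i then cos t * x $ i - sin t * x $ j
      else if a = j then sin t * x $ i + cos t * x $ j else x $ a)"
proof -
  have two: "(\<Sum>b\<in>UNIV. (if b = i then c else if b = j then d else 0) * x $ b) = c * x $ i + d * x $ j" for c d
  proof -
    have "(\<Sum>b\<in>UNIV. (if b = i then c else if b = j then d else 0) * x $ b) =
      (\<Sum>b\<in>UNIV. (if b = i then c * x $ b else 0) + (if b = j then d * x $ b else 0))"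
      using assms by (intro sum.cong) auto
    then show ?thesis by (simp add: sum.distrib)
  qed
  show ?thesis
    using assms
    by (simp add: plane_rot_def matrix_vector_mult_def two)
       (simp add: if_distrib[where f="\<lambda>r. r * _"] cong: if_cong)
qed

lemma plane_rot_add:
  assumes "i \<noteq> j"
  shows "plane_rot i j s ** plane_rot i j t = plane_rot i j (s + t)"
  unfolding matrix_eq matrix_vector_mul_assoc[symmetric] vec_eq_iff plane_rot_mult[OF assms]
  using assms by (auto simp: cos_add sin_add algebra_simps)

lemma plane_rot_zero: "i \<noteq> j \<Longrightarrow> plane_rot i j 0 = mat 1"
  unfolding matrix_eq vec_eq_iff by (auto simp: plane_rot_mult)

lemma rotation_matrix_plane_rot:
  assumes "i \<noteq> j"
  shows "rotation_matrix (plane_rot i j t)"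
proof -
  have tr: "transpose (plane_rot i j t) = plane_rot i j (- t)" for t
    using assms by (auto simp: transpose_def plane_rot_def vec_eq_iff)
  have orth: "orthogonal_matrix (plane_rot i j t)" for t
    using assms by (simp add: orthogonal_matrix_def tr plane_rot_add plane_rot_zero)
  \<comment> \<open>Orthogonality leaves the determinant 1 or -1; being the square of a rotation by
    half the angle decides for 1.\<close>
  have "plane_rot i j t = plane_rot i j (t / 2) ** plane_rot i j (t / 2)"
    using assms by (simp add: plane_rot_add)
  moreover have "det (plane_rot i j (t / 2)) = 1 \<or> det (plane_rot i j (t / 2)) = - 1"
    by (rule det_orthogonal_matrix[OF orth])
  ultimately have "det (plane_rot i j t) = 1" by (auto simp: det_mul)
  with orth show ?thesis by (simp add: rotation_matrix_def)
qed

text \<open>The infinitesimal generator of \<open>plane_rot i j\<close>. In contrast to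
  \<open>rot_deriv\<close> it uses ambient partial derivatives without radial extension, so it maps
  polynomials to polynomials.\<close>

definition rot_field :: "'d::finite \<Rightarrow> 'd \<Rightarrow> (real ^ 'd \<Rightarrow> complex) \<Rightarrow> real ^ 'd \<Rightarrow> complex" where
  "rot_field i j p x = of_real (x $ i) * partial_deriv j p x - of_real (x $ j) * partial_deriv i p x"

lemma polynomial_function_plane_rot_deriv:
  fixes p :: "real ^ 'd \<Rightarrow> complex"
  assumes "polynomial_function p" "i \<noteq> j"
  shows "((\<lambda>t. p (plane_rot i j t *v x)) has_vector_derivative rot_field i j p (plane_rot i j t *v x)) (at t)"
proof -
  define y where "y = (\<lambda>t. plane_rot i j t *v x)"
  \<comment> \<open>Only two coordinates move along the orbit, so it is differentiated as a
    combination of two fixed axis vectors.\<close>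
  have "y = (\<lambda>t. x + (cos t * x $ i - sin t * x $ j - x $ i) *\<^sub>R axis i 1
      + (sin t * x $ i + cos t * x $ j - x $ j) *\<^sub>R axis j 1)"
    using assms(2) by (auto simp: y_def fun_eq_iff vec_eq_iff plane_rot_mult axis_def)
  moreover have "((\<lambda>t. x + (cos t * x $ i - sin t * x $ j - x $ i) *\<^sub>R axis i 1
      + (sin t * x $ i + cos t * x $ j - x $ j) *\<^sub>R axis j 1) has_derivative
      (\<lambda>h. (h * (- y t $ j)) *\<^sub>R axis i 1 + (h * y t $ i) *\<^sub>R axis j 1)) (at t)"
    using assms(2)
    by (auto intro!: derivative_eq_intros simp: y_def plane_rot_mult fun_eq_iff vec_eq_iff axis_def algebra_simps)
  ultimately have dy: "(y has_derivative (\<lambda>h. (h * (- y t $ j)) *\<^sub>R axis i 1 + (h * y t $ i) *\<^sub>R axis j 1)) (at t)"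
    by simp
  have "((\<lambda>t. p (y t)) has_derivative (\<lambda>h. \<Sum>a\<in>UNIV. ((h * (- y t $ j)) *\<^sub>R axis i 1 + (h * y t $ i) *\<^sub>R axis j 1) $ a *\<^sub>R partial_deriv a p (y t))) (at t)"
    by (rule has_derivative_compose[OF dy polynomial_function_has_derivative[OF assms(1)]])
  moreover have "(\<Sum>a\<in>UNIV. ((h * (- y t $ j)) *\<^sub>R axis i 1 + (h * y t $ i) *\<^sub>R axis j 1) $ a *\<^sub>R partial_deriv a p (y t))
     = h *\<^sub>R rot_field i j p (y t)" for h
  proof -
    have "(\<Sum>a\<in>UNIV. ((h * (- y t $ j)) *\<^sub>R axis i 1 + (h * y t $ i) *\<^sub>R axis j 1) $ a *\<^sub>R partial_deriv a p (y t))
      = (\<Sum>a\<in>UNIV. (if a = i then (h * (- y t $ j)) *\<^sub>R partial_deriv a p (y t) else 0)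
           + (if a = j then (h * y t $ i) *\<^sub>R partial_deriv a p (y t) else 0))"
      by (intro sum.cong) (auto simp: axis_def scaleR_left_distrib)
    then show ?thesis
      by (simp add: sum.distrib rot_field_def scaleR_conv_of_real algebra_simps)
  qed
  ultimately show ?thesis by (simp add: has_vector_derivative_def y_def)
qed


text \<open>Along the orbit each coordinate is a combination of \<open>cis t\<close>,
  \<open>cis (- t)\<close> and constants. Taking out one factor \<open>cis (- t)\<close> per
  coordinate factor leaves a polynomial in \<open>cis t\<close> of degree at most 2, hence at most
  \<open>2 * k\<close> for a monomial of degree \<open>k\<close>.\<close>

lemma monomials_plane_rot_cis:
  assumes "i \<noteq> j" "p \<in> cfun.span (monomials k)"
  shows "\<exists>P. degree P \<le> 2 * k \<and> (\<forall>t. p (plane_rot i j t *v x) = cis (- t) ^ k * poly P (cis t))"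
  using assms(2)
proof (induction rule: cfun.span_induct_alt)
  case base
  show ?case by (intro exI[of _ 0]) simp
next
  case (step c m p)
  then obtain \<alpha> P where \<alpha>: "m = monomial_fun \<alpha>" "sum \<alpha> UNIV = k" and P: "degree P \<le> 2 * k"
    "\<And>t. p (plane_rot i j t *v x) = cis (- t) ^ k * poly P (cis t)"
    by (auto simp: monomials_def)
  \<comment> \<open>Euler's formulas for cos and sin applied to the two moving coordinates. A fixed
    coordinate gets the factor \<open>cis t\<close> that cancels \<open>cis (- t)\<close>.\<close>
  define q where "q = (\<lambda>a. let u = of_real (x $ i) / 2; v = \<i> * of_real (x $ j) / 2;
        u' = of_real (x $ j) / 2; v' = \<i> * of_real (x $ i) / 2 in
      if a = i then [:u - v, 0, u + v:] else if a = j then [:u' + v', 0, u' - v':] else [:0, of_real (x $ a):])"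
  have q: "of_real ((plane_rot i j t *v x) $ a) = cis (- t) * poly (q a) (cis t)" for a t
  proof -
    have one: "cis (- t) * cis t = 1" by (simp add: cis_mult)
    have *: "cis (- t) * poly [:c, 0, d:] (cis t) = c * cis (- t) + d * cis t"
      "cis (- t) * poly [:0, c:] (cis t) = c" for c d
      using one by (simp_all, algebra+)
    show ?thesis
      using assms(1) unfolding q_def Let_def
      by (auto simp only: * if_distrib[where f="\<lambda>q. cis (- t) * poly q (cis t)"] plane_rot_mult)
         (auto simp: complex_eq_iff plane_rot_mult)
  qed
  have deg_q: "degree (q a) \<le> 2" for a
    by (simp add: q_def Let_def)
  define R where "R = (\<Prod>a\<in>UNIV. q a ^ \<alpha> a)"
  have "degree R \<le> (\<Sum>a\<in>UNIV. degree (q a ^ \<alpha> a))"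
    using degree_prod_sum_le[of UNIV "\<lambda>a. q a ^ \<alpha> a"] by (simp add: R_def o_def)
  also have "\<dots> \<le> (\<Sum>a\<in>UNIV. 2 * \<alpha> a)"
    by (intro sum_mono order_trans[OF degree_power_le] mult_right_mono deg_q) simp
  finally have "degree R \<le> 2 * k"
    by (simp add: \<alpha>(2) flip: sum_distrib_left)
  moreover have "m (plane_rot i j t *v x) = cis (- t) ^ k * poly R (cis t)" for t
    by (simp add: \<alpha>(1) monomial_fun_def q R_def poly_prod power_mult_distrib prod.distrib
        power_sum[symmetric] \<alpha>(2))
  ultimately show ?case using P
    by (intro exI[of _ "smult c R + P"]) (auto simp: degree_add_le algebra_simps)
qed


subsection \<open>Harmonic polynomials on the sphere\<close>

locale sphere_harmonics =
  fixes \<sigma> :: "(real ^ 'd::finite) measure" and Y :: "nat \<Rightarrow> nat \<Rightarrow> real ^ 'd \<Rightarrow> complex"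
  assumes card_ge_2: "CARD('d) \<ge> 2"
    and sphere_measure: "normalized_sphere_measure \<sigma>"
    and orthonormal_basis: "orthonormal_harmonic_basis \<sigma> Y"
begin

section \<open>Rotation-invariant integration over the sphere\<close>

lemma space_sigma [simp]: "space \<sigma> = sphere 0 1"
  using sphere_measure sets_eq_imp_space_eq[of \<sigma> "restrict_space borel (sphere 0 1)"]
  by (simp add: normalized_sphere_measure_def space_restrict_space)

lemma sets_sigma: "sets \<sigma> = sets (restrict_space borel (sphere 0 1))"
  using sphere_measure by (simp add: normalized_sphere_measure_def)

lemma measure_sigma: "measure \<sigma> (sphere 0 1) = 1"
  using sphere_measure by (simp add: normalized_sphere_measure_def measure_def)

lemma finite_measure_sigma: "finite_measure \<sigma>"
  using sphere_measure by (intro finite_measureI) (simp add: normalized_sphere_measure_def)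

lemma borel_measurable_sigma:
  fixes f :: "real ^ 'd \<Rightarrow> 'b::topological_space"
  assumes "continuous_on UNIV f"
  shows "f \<in> borel_measurable \<sigma>"
proof -
  have "f \<in> borel_measurable borel" by (rule borel_measurable_continuous_onI[OF assms])
  then have "f \<in> borel_measurable (restrict_space borel (sphere 0 1))"
    by (rule measurable_restrict_space1)
  then show ?thesis by (simp cong: measurable_cong_sets add: sets_sigma)
qed

lemma integrable_sigma:
  fixes f :: "real ^ 'd \<Rightarrow> 'b::{banach, second_countable_topology}"
  assumes "continuous_on UNIV f"
  shows "integrable \<sigma> f"
proof -
  interpret finite_measure \<sigma> by (rule finite_measure_sigma)
  have "compact (f ` sphere 0 1)"
    by (intro compact_continuous_image continuous_on_subset[OF assms] compact_sphere) auto
  then obtain B where "\<And>x. x \<in> sphere 0 1 \<Longrightarrow> norm (f x) \<le> B"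
    using compact_imp_bounded bounded_iff by (metis imageI)
  then show ?thesis
    by (intro integrable_const_bound[of _ B] borel_measurable_sigma[OF assms] AE_I2) auto
qed

lemma integral_rotation:
  fixes f :: "real ^ 'd \<Rightarrow> 'b::{banach, second_countable_topology}"
  assumes "continuous_on UNIV f" "rotation_matrix Q"
  shows "(LINT x|\<sigma>. f (Q *v x)) = (LINT x|\<sigma>. f x)"
proof -
  have "orthogonal_transformation (\<lambda>x. Q *v x)"
    using assms(2) by (simp add: rotation_matrix_def orthogonal_transformation_matrix matrix_vector_mul_linear)
  then have nQ: "norm (Q *v x) = norm x" for x
    by (simp add: orthogonal_transformation_norm)
  have "(\<lambda>x. Q *v x) \<in> measurable (restrict_space borel (sphere 0 1)) (restrict_space borel (sphere 0 1))"
    by (rule measurable_restrict_space3)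
       (auto simp: nQ intro!: borel_measurable_continuous_onI linear_continuous_on matrix_vector_mul_bounded_linear)
  then have "(\<lambda>x. Q *v x) \<in> measurable \<sigma> \<sigma>"
    by (simp cong: measurable_cong_sets add: sets_sigma)
  from integral_distr[OF this borel_measurable_sigma[OF assms(1)]]
  show ?thesis using sphere_measure assms(2) by (simp add: normalized_sphere_measure_def)
qed

section \<open>Expansion in the orthonormal basis\<close>

lemma harmonic_basis_span: "cfun.span (Y k ` {1..harmonic_dim TYPE('d) k}) = harmonic_polys k"
  and harmonic_basis_inj: "inj_on (Y k) {1..harmonic_dim TYPE('d) k}"
  and harmonic_basis_orthonormal:
    "l \<in> {1..harmonic_dim TYPE('d) k} \<Longrightarrow> m \<in> {1..harmonic_dim TYPE('d) k} \<Longrightarrow>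
      (LINT \<theta>|\<sigma>. Y k l \<theta> * cnj (Y k m \<theta>)) = (if l = m then 1 else 0)"
  using orthonormal_basis unfolding orthonormal_harmonic_basis_def by blast+

text \<open>Linearity is read off from the basis: the harmonic polynomials of degree
  \<open>k\<close> are a span.\<close>

lemma subspace_harmonic_polys: "cfun.subspace (harmonic_polys k :: (real ^ 'd \<Rightarrow> complex) set)"
  unfolding harmonic_basis_span[symmetric] by (rule cfun.subspace_span)

lemma harmonic_polys_scale:
  "p \<in> harmonic_polys k \<Longrightarrow> (\<lambda>x. c * p x) \<in> harmonic_polys k" for p :: "real ^ 'd \<Rightarrow> complex"
  by (rule cfun.subspace_scale[OF subspace_harmonic_polys])

lemma harmonic_polys_sum:
  fixes p :: "'b \<Rightarrow> real ^ 'd \<Rightarrow> complex"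
  assumes "\<And>s. s \<in> A \<Longrightarrow> p s \<in> harmonic_polys k"
  shows "(\<lambda>x. \<Sum>s\<in>A. c s * p s x) \<in> harmonic_polys k"
proof -
  have "(\<Sum>s\<in>A. (\<lambda>x. c s * p s x)) \<in> harmonic_polys k"
    by (intro cfun.subspace_sum[OF subspace_harmonic_polys] harmonic_polys_scale assms)
  moreover have "(\<Sum>s\<in>A. (\<lambda>x. c s * p s x)) = (\<lambda>x. \<Sum>s\<in>A. c s * p s x)"
    by (simp add: fun_eq_iff sum_fun_apply)
  ultimately show ?thesis by simp
qed

lemma Y_harmonic: "l \<in> {1..harmonic_dim TYPE('d) k} \<Longrightarrow> Y k l \<in> harmonic_polys k"
  unfolding harmonic_basis_span[symmetric] by (intro cfun.span_base imageI)

lemma continuous_harmonic: "p \<in> harmonic_polys k \<Longrightarrow> continuous_on UNIV p" for p :: "real ^ 'd \<Rightarrow> complex"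
  by (intro continuous_on_polymonial_function) (simp add: harmonic_polys_def)

lemma harmonic_expansion:
  assumes "p \<in> harmonic_polys k"
  obtains b where "p = (\<lambda>x. \<Sum>l=1..harmonic_dim TYPE('d) k. b l * Y k l x)"
proof -
  have "p \<in> cfun.span (Y k ` {1..harmonic_dim TYPE('d) k})" using assms harmonic_basis_span by simp
  then obtain u where u: "p = (\<Sum>v\<in>Y k ` {1..harmonic_dim TYPE('d) k}. (\<lambda>x. u v * v x))"
    by (subst (asm) cfun.span_finite) auto
  have "p = (\<lambda>x. \<Sum>l=1..harmonic_dim TYPE('d) k. u (Y k l) * Y k l x)"
    unfolding u sum.reindex[OF harmonic_basis_inj] by (simp add: fun_eq_iff sum_fun_apply)
  then show thesis by (rule that)
qed

lemma L2_norm_expansion: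
  "(LINT x|\<sigma>. (cmod (\<Sum>l=1..harmonic_dim TYPE('d) k. b l * Y k l x))\<^sup>2) = (\<Sum>l=1..harmonic_dim TYPE('d) k. (cmod (b l))\<^sup>2)"
proof -
  have cont: "continuous_on UNIV (Y k l)" if "l \<in> {1..harmonic_dim TYPE('d) k}" for l
    by (rule continuous_harmonic[OF Y_harmonic[OF that]])
  have "complex_of_real (LINT x|\<sigma>. (cmod (\<Sum>l=1..harmonic_dim TYPE('d) k. b l * Y k l x))\<^sup>2) =
    (LINT x|\<sigma>. complex_of_real ((cmod (\<Sum>l=1..harmonic_dim TYPE('d) k. b l * Y k l x))\<^sup>2))"
    by (rule integral_complex_of_real[symmetric])
  also have "\<dots> = (LINT x|\<sigma>. (\<Sum>l=1..harmonic_dim TYPE('d) k. \<Sum>m=1..harmonic_dim TYPE('d) k. b l * cnj (b m) * (Y k l x * cnj (Y k m x))))"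
    by (simp only: complex_norm_square cnj_sum complex_cnj_mult sum_product mult_ac)
  also have "\<dots> = (\<Sum>l=1..harmonic_dim TYPE('d) k. \<Sum>m=1..harmonic_dim TYPE('d) k. b l * cnj (b m) * (LINT x|\<sigma>. Y k l x * cnj (Y k m x)))"
  proof -
    have int: "integrable \<sigma> (\<lambda>x. b l * cnj (b m) * (Y k l x * cnj (Y k m x)))"
      if "l \<in> {1..harmonic_dim TYPE('d) k}" "m \<in> {1..harmonic_dim TYPE('d) k}" for l m
      by (intro integrable_sigma continuous_intros cont that)
    have "(LINT x|\<sigma>. (\<Sum>l=1..harmonic_dim TYPE('d) k. \<Sum>m=1..harmonic_dim TYPE('d) k. b l * cnj (b m) * (Y k l x * cnj (Y k m x))))
      = (\<Sum>l=1..harmonic_dim TYPE('d) k. LINT x|\<sigma>. (\<Sum>m=1..harmonic_dim TYPE('d) k. b l * cnj (b m) * (Y k l x * cnj (Y k m x))))"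
      by (rule Bochner_Integration.integral_sum) (intro Bochner_Integration.integrable_sum int)
    also have "\<dots> = (\<Sum>l=1..harmonic_dim TYPE('d) k. \<Sum>m=1..harmonic_dim TYPE('d) k. LINT x|\<sigma>. b l * cnj (b m) * (Y k l x * cnj (Y k m x)))"
      by (intro sum.cong refl Bochner_Integration.integral_sum int)
    finally show ?thesis by (simp only: integral_mult_right_zero)
  qed
  also have "\<dots> = (\<Sum>l=1..harmonic_dim TYPE('d) k. \<Sum>m=1..harmonic_dim TYPE('d) k. if l = m then b l * cnj (b m) else 0)"
    by (intro sum.cong refl) (simp add: harmonic_basis_orthonormal)
  also have "\<dots> = (\<Sum>l=1..harmonic_dim TYPE('d) k. b l * cnj (b l))"
    by (intro sum.cong refl) (simp add: sum.delta)
  also have "\<dots> = of_real (\<Sum>l=1..harmonic_dim TYPE('d) k. (cmod (b l))\<^sup>2)"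
    by (simp only: of_real_sum complex_norm_square)
  finally show ?thesis unfolding of_real_eq_iff .
qed

section \<open>The reproducing kernel and pointwise bounds\<close>

text \<open>The diagonal of the reproducing kernel of \<open>harmonic_polys k\<close> with respect
  to the L2 inner product of \<open>\<sigma>\<close>.\<close>

definition zonal :: "nat \<Rightarrow> real ^ 'd \<Rightarrow> real" where
  "zonal k x = (\<Sum>l=1..harmonic_dim TYPE('d) k. (cmod (Y k l x))\<^sup>2)"

text \<open>Cauchy-Schwarz for the basis expansion, whose coefficients carry the L2-norm.\<close>

lemma harmonic_eval_le_zonal:
  assumes "p \<in> harmonic_polys k"
  shows "(cmod (p x))\<^sup>2 \<le> zonal k x * (LINT x|\<sigma>. (cmod (p x))\<^sup>2)"
proof -
  obtain b where b: "p = (\<lambda>x. \<Sum>l=1..harmonic_dim TYPE('d) k. b l * Y k l x)" by (rule harmonic_expansion[OF assms])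
  have "(cmod (p x))\<^sup>2 \<le> (\<Sum>l=1..harmonic_dim TYPE('d) k. cmod (b l) * cmod (Y k l x))\<^sup>2"
    unfolding b by (intro power_mono order_trans[OF norm_sum]) (auto simp: norm_mult)
  also have "\<dots> \<le> (\<Sum>l=1..harmonic_dim TYPE('d) k. (cmod (b l))\<^sup>2) * zonal k x"
    unfolding zonal_def by (rule Cauchy_Schwarz_ineq_sum)
  finally show ?thesis unfolding b L2_norm_expansion by (simp add: mult.commute)
qed

text \<open>Evaluate at \<open>x\<close> the rotation of the reproducing kernel of the point \<open>Q *v x\<close>.\<close>

lemma zonal_rotation_le:
  assumes "rotation_matrix Q"
  shows "zonal k (Q *v x) \<le> zonal k x"
proof -
  define p where "p = (\<lambda>y. \<Sum>l=1..harmonic_dim TYPE('d) k. cnj (Y k l (Q *v x)) * Y k l y)"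
  have p: "p \<in> harmonic_polys k" unfolding p_def by (intro harmonic_polys_sum Y_harmonic)
  then have pQ: "(\<lambda>y. p (Q *v y)) \<in> harmonic_polys k"
    using assms by (intro harmonic_polys_compose_orthogonal) (auto simp: rotation_matrix_def)
  have "p (Q *v x) = of_real (zonal k (Q *v x))"
    by (simp add: p_def zonal_def complex_norm_square mult.commute del: of_real_power)
  then have "(zonal k (Q *v x))\<^sup>2 \<le> zonal k x * (LINT y|\<sigma>. (cmod (p (Q *v y)))\<^sup>2)"
    using harmonic_eval_le_zonal[OF pQ, of x] by simp
  also have "(LINT y|\<sigma>. (cmod (p (Q *v y)))\<^sup>2) = (LINT y|\<sigma>. (cmod (p y))\<^sup>2)"
    by (rule integral_rotation[OF _ assms, where f="\<lambda>y. (cmod (p y))\<^sup>2"])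
       (intro continuous_intros continuous_harmonic[OF p])
  also have "\<dots> = zonal k (Q *v x)"
    unfolding p_def L2_norm_expansion by (simp add: zonal_def)
  finally have "zonal k (Q *v x) * zonal k (Q *v x) \<le> zonal k x * zonal k (Q *v x)"
    by (simp add: power2_eq_square)
  moreover have "zonal k y \<ge> 0" for y by (simp add: zonal_def sum_nonneg)
  ultimately show ?thesis
    using mult_right_le_imp_le[of "zonal k (Q *v x)" "zonal k (Q *v x)" "zonal k x"]
    by (metis order_le_less)
qed

text \<open>Rotations act transitively on the sphere, so the rotation inequality in both directions
  makes \<open>zonal k\<close> constant there. The constant is its mean over a probability measure,
  namely the number of basis elements of norm 1.\<close>

lemma zonal_eq:
  assumes "norm x = 1"
  shows "zonal k x = real (harmonic_dim TYPE('d) k)"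
proof -
  have le: "zonal k y \<le> zonal k x" if xy: "norm x = 1" "norm y = 1" for x y
  proof -
    \<comment> \<open>Transitivity with determinant 1 is where the dimension must be at least
      2.\<close>
    obtain f where f: "orthogonal_transformation f" "det (matrix f) = 1" "f x = y"
      by (rule rotation_exists_1[OF card_ge_2 xy])
    then have "rotation_matrix (matrix f)" "f x = matrix f *v x"
      using orthogonal_transformation_matrix[of f]
      by (auto simp: rotation_matrix_def matrix_works orthogonal_transformation_linear)
    then show ?thesis using zonal_rotation_le f(3) by metis
  qed
  have "(LINT y|\<sigma>. zonal k y) = (LINT y|\<sigma>. zonal k x)"
    using le assms by (intro Bochner_Integration.integral_cong) (auto intro!: antisym)
  then have "(LINT y|\<sigma>. zonal k y) = zonal k x"
    by (simp add: measure_sigma)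
  moreover have "(LINT y|\<sigma>. zonal k y) = (\<Sum>l=1..harmonic_dim TYPE('d) k. LINT y|\<sigma>. (cmod (Y k l y))\<^sup>2)"
    unfolding zonal_def
    by (intro Bochner_Integration.integral_sum integrable_sigma continuous_intros continuous_harmonic[OF Y_harmonic])
  moreover have "(LINT y|\<sigma>. (cmod (Y k l y))\<^sup>2) = 1" if "l \<in> {1..harmonic_dim TYPE('d) k}" for l
  proof -
    \<comment> \<open>A basis element is written as an expansion with Kronecker coefficients, so
      that the L2 formula applies.\<close>
    have "(LINT y|\<sigma>. (cmod (Y k l y))\<^sup>2) = (LINT y|\<sigma>. (cmod (\<Sum>m=1..harmonic_dim TYPE('d) k. (if m = l then 1 else 0) * Y k m y))\<^sup>2)"
      using that by (simp add: if_distrib[where f="\<lambda>r. r * _"] cong: if_cong)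
    also have "\<dots> = 1"
      unfolding L2_norm_expansion using that by (simp add: if_distrib[where f=cmod] if_distrib[where f="\<lambda>r. r\<^sup>2"] cong: if_cong)
    finally show ?thesis .
  qed
  ultimately show ?thesis by simp
qed

lemma harmonic_eval_le:
  assumes "p \<in> harmonic_polys k" "norm x = 1"
  shows "(cmod (p x))\<^sup>2 \<le> real (harmonic_dim TYPE('d) k) * (LINT x|\<sigma>. (cmod (p x))\<^sup>2)"
  using harmonic_eval_le_zonal[OF assms(1), of x] zonal_eq[OF assms(2)] by simp


text \<open>Averaging over \<open>N = 2 * k + 1\<close> equally spaced rotations of the plane replaces an integral over all of
  them: it recovers the Fourier coefficients, which are therefore harmonic again, and Parseval holds
  exactly, so no Fubini argument is needed.\<close>

lemma rot_field_harmonic: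
  assumes p: "p \<in> harmonic_polys k"
  shows rot_field_mem: "rot_field i j p \<in> harmonic_polys k"
    and rot_field_L2: "(LINT x|\<sigma>. (cmod (rot_field i j p x))\<^sup>2) \<le> (real k)\<^sup>2 * (LINT x|\<sigma>. (cmod (p x))\<^sup>2)"
proof -
  have "rot_field i j p \<in> harmonic_polys k \<and>
    (LINT x|\<sigma>. (cmod (rot_field i j p x))\<^sup>2) \<le> (real k)\<^sup>2 * (LINT x|\<sigma>. (cmod (p x))\<^sup>2)"
  proof (cases "i = j")
    case True
    then have "rot_field i j p = (\<lambda>x. 0 * p x)" by (simp add: rot_field_def fun_eq_iff)
    then show ?thesis using harmonic_polys_scale[OF p, of 0] by simp
  next
    case False
    \<comment> \<open>The frequencies \<open>n - k\<close> with \<open>n \<le> 2 * k\<close> run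
      from -k to k, which makes \<open>2 * k + 1\<close> of them.\<close>
    define N where "N = 2 * k + 1"
    define w where "w = (\<lambda>s::nat. cis (2 * pi * real s / real N))"
    define Q :: "nat \<Rightarrow> real ^ 'd ^ 'd" where "Q = (\<lambda>s. plane_rot i j (2 * pi * real s / real N))"
    have w_norm: "cmod (w s) = 1" for s by (simp add: w_def)
    have rotQ: "rotation_matrix (Q s)" for s unfolding Q_def by (rule rotation_matrix_plane_rot[OF False])
    have pQ: "(\<lambda>x. p (Q s *v x)) \<in> harmonic_polys k" for s
      using rotQ by (intro harmonic_polys_compose_orthogonal[OF p]) (simp add: rotation_matrix_def)
    have poly_p: "polynomial_function p" using p by (simp add: harmonic_polys_def)
    have "\<forall>x. \<exists>P. degree P \<le> 2 * k \<and> (\<forall>t. p (plane_rot i j t *v x) = cis (- t) ^ k * poly P (cis t))"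
      using monomials_plane_rot_cis[OF False] p harmonic_polys_subset_span by blast
    then obtain P where deg: "\<And>x. degree (P x) \<le> 2 * k"
      and P: "\<And>x t. p (plane_rot i j t *v x) = cis (- t) ^ k * poly (P x) (cis t)" by metis
    \<comment> \<open>\<open>c n x\<close> is the Fourier coefficient of frequency
      \<open>n - k\<close> of \<open>p\<close> on the orbit through \<open>x\<close>.\<close>
    define c where "c = (\<lambda>n x. coeff (P x) n)"
    have expand: "p (plane_rot i j t *v x) = cis (- t) ^ k * (\<Sum>n<N. c n x * cis t ^ n)" for t x
    proof -
      have "poly (P x) z = (\<Sum>n<N. c n x * z ^ n)" for z
        unfolding c_def poly_altdef using deg[of x]
        by (intro sum.mono_neutral_left) (auto simp: N_def coeff_eq_0)
      then show ?thesis by (simp add: P)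
    qed
    \<comment> \<open>Multiplying by the k-th power of \<open>w s\<close> clears the negative
      frequencies, so the discrete orthogonality applies.\<close>
    have expandQ: "(\<Sum>n<N. c n x * w s ^ n) = w s ^ k * p (Q s *v x)" for s x
    proof -
      have "w s ^ k * cnj (w s) ^ k = 1"
        by (simp add: w_def cis_cnj cis_mult flip: power_mult_distrib)
      then show ?thesis by (simp add: Q_def expand w_def cis_cnj mult.assoc[symmetric])
    qed
    have c_harm: "c n \<in> harmonic_polys k" if "n < N" for n
    proof -
      have "c n x = (\<Sum>s<N. (w s ^ k * cnj (w s) ^ n / of_nat N) * p (Q s *v x))" for x
      proof -
        have "(\<Sum>s<N. (w s ^ k * cnj (w s) ^ n / of_nat N) * p (Q s *v x)) =
          (\<Sum>s<N. \<Sum>m<N. c m x * (w s ^ m * cnj (w s) ^ n)) / of_nat N"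
        proof (subst sum_divide_distrib, intro sum.cong refl)
          fix s
          have "w s ^ k * cnj (w s) ^ n / of_nat N * p (Q s *v x) =
            cnj (w s) ^ n * (\<Sum>m<N. c m x * w s ^ m) / of_nat N"
            unfolding expandQ by simp
          then show "w s ^ k * cnj (w s) ^ n / of_nat N * p (Q s *v x) =
            (\<Sum>m<N. c m x * (w s ^ m * cnj (w s) ^ n)) / of_nat N"
            by (simp add: sum_distrib_left mult_ac)
        qed
        also have "(\<Sum>s<N. \<Sum>m<N. c m x * (w s ^ m * cnj (w s) ^ n)) =
          (\<Sum>m<N. c m x * (\<Sum>s<N. w s ^ m * cnj (w s) ^ n))"
          unfolding sum_distrib_left by (rule sum.swap)
        also have "\<dots> = (\<Sum>m<N. if m = n then c m x * of_nat N else 0)"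
          using that by (intro sum.cong refl) (auto simp: w_def sum_roots_of_unity simp del: cis_cnj)
        also have "\<dots> = c n x * of_nat N" using that by simp
        finally show ?thesis using that by simp
      qed
      then have "c n = (\<lambda>x. \<Sum>s<N. (w s ^ k * cnj (w s) ^ n / of_nat N) * p (Q s *v x))" ..
      then show ?thesis by (simp only: harmonic_polys_sum pQ)
    qed
    \<comment> \<open>The chain rule along the orbit and termwise differentiation of the
      trigonometric polynomial compute the same derivative.\<close>
    have deriv: "rot_field i j p (plane_rot i j t *v x) =
      cis (- t) ^ k * (\<Sum>n<N. \<i> * of_real (real n - real k) * c n x * cis t ^ n)" for t x
    proof -
      have "p (plane_rot i j t *v x) = (\<Sum>n<N. c n x * cis ((real n - real k) * t))" for t
        by (simp add: expand sum_distrib_left Complex.DeMoivre cis_mult algebra_simps)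
      then have eq: "(\<lambda>t. p (plane_rot i j t *v x)) = (\<lambda>t. \<Sum>n<N. c n x * cis ((real n - real k) * t))" ..
      have "((\<lambda>t. p (plane_rot i j t *v x)) has_vector_derivative
        (\<Sum>n<N. c n x * (of_real (real n - real k) * (\<i> * cis ((real n - real k) * t))))) (at t)"
        unfolding eq
        by (intro derivative_intros) (auto simp: has_vector_derivative_def scaleR_conv_of_real intro!: derivative_eq_intros)
      with polynomial_function_plane_rot_deriv[OF poly_p False, of x t]
      have "rot_field i j p (plane_rot i j t *v x) =
        (\<Sum>n<N. c n x * (of_real (real n - real k) * (\<i> * cis ((real n - real k) * t))))"
        by (rule vector_derivative_unique_at)
      then show ?thesis
        by (simp add: sum_distrib_left Complex.DeMoivre cis_mult algebra_simps)
    qed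
    have field: "rot_field i j p = (\<lambda>x. \<Sum>n<N. (\<i> * of_real (real n - real k)) * c n x)"
      using deriv[of 0] plane_rot_zero[OF False] by (simp add: fun_eq_iff)
    then have mem: "rot_field i j p \<in> harmonic_polys k"
      using harmonic_polys_sum[of "{..<N}" c k] c_harm by auto
    define J where "J = (\<lambda>n. LINT x|\<sigma>. (cmod (c n x))\<^sup>2)"
    \<comment> \<open>Stated for general multipliers \<open>b\<close> so that it serves twice: with
      \<open>b n = 1\<close> for \<open>p\<close>, and with the factors \<open>n - k\<close> (times
      the imaginary unit) for \<open>rot_field i j p\<close>.\<close>
    have parseval: "real N * (LINT x|\<sigma>. (cmod (f x))\<^sup>2) = real N * (\<Sum>n<N. (cmod (b n))\<^sup>2 * J n)"
      if f: "f \<in> harmonic_polys k"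
        and fQ: "\<And>s x. cmod (f (Q s *v x)) = cmod (\<Sum>n<N. b n * c n x * w s ^ n)" for f b
    proof -
      have int: "integrable \<sigma> (\<lambda>x. (cmod (g x))\<^sup>2)" if "g \<in> harmonic_polys k" for g :: "real ^ 'd \<Rightarrow> complex"
        using that by (intro integrable_sigma continuous_intros continuous_harmonic)
      have fQh: "(\<lambda>x. f (Q s *v x)) \<in> harmonic_polys k" for s
        using rotQ by (intro harmonic_polys_compose_orthogonal[OF f]) (simp add: rotation_matrix_def)
      have "real N * (LINT x|\<sigma>. (cmod (f x))\<^sup>2) = (\<Sum>s<N. (LINT x|\<sigma>. (cmod (f (Q s *v x)))\<^sup>2))"
        using integral_rotation[OF _ rotQ, where f="\<lambda>x. (cmod (f x))\<^sup>2"]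
        by (simp add: continuous_intros continuous_harmonic[OF f])
      also have "\<dots> = (LINT x|\<sigma>. (\<Sum>s<N. (cmod (f (Q s *v x)))\<^sup>2))"
        by (rule Bochner_Integration.integral_sum[symmetric]) (rule int[OF fQh])
      also have "\<dots> = (LINT x|\<sigma>. real N * (\<Sum>n<N. (cmod (b n * c n x))\<^sup>2))"
        unfolding fQ w_def discrete_parseval ..
      also have "\<dots> = real N * (\<Sum>n<N. LINT x|\<sigma>. (cmod (b n))\<^sup>2 * (cmod (c n x))\<^sup>2)"
        unfolding integral_mult_right_zero norm_mult power_mult_distrib
        by (subst Bochner_Integration.integral_sum) (auto intro!: int c_harm)
      finally show ?thesis by (simp add: J_def)
    qed
    have N0: "real N > 0" by (simp add: N_def)
    have eq1: "(LINT x|\<sigma>. (cmod (p x))\<^sup>2) = (\<Sum>n<N. J n)"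
    proof -
      have "cmod (p (Q s *v x)) = cmod (\<Sum>n<N. 1 * c n x * w s ^ n)" for s x
        by (simp add: expandQ norm_mult norm_power w_norm)
      from parseval[OF p this] N0 show ?thesis by simp
    qed
    have eq2: "(LINT x|\<sigma>. (cmod (rot_field i j p x))\<^sup>2) = (\<Sum>n<N. (real n - real k)\<^sup>2 * J n)"
    proof -
      have "cmod (rot_field i j p (Q s *v x)) = cmod (\<Sum>n<N. (\<i> * of_real (real n - real k)) * c n x * w s ^ n)" for s x
        unfolding Q_def deriv w_def norm_mult norm_power by simp
      from parseval[OF mem this] N0 show ?thesis by (simp add: norm_mult del: of_real_diff)
    qed
    \<comment> \<open>No frequency exceeds \<open>k\<close> in absolute value; this yields the
      operator bound \<open>k\<close>.\<close>
    have "(\<Sum>n<N. (real n - real k)\<^sup>2 * J n) \<le> (\<Sum>n<N. (real k)\<^sup>2 * J n)"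
    proof (intro sum_mono mult_right_mono)
      fix n assume "n \<in> {..<N}"
      then have "\<bar>real n - real k\<bar> \<le> \<bar>real k\<bar>" by (auto simp: N_def)
      then show "(real n - real k)\<^sup>2 \<le> (real k)\<^sup>2" by (simp only: abs_le_square_iff)
      show "0 \<le> J n" by (simp add: J_def)
    qed
    then show ?thesis using mem by (simp only: eq1 eq2 sum_distrib_left simp_thms)
  qed
  then show "rot_field i j p \<in> harmonic_polys k"
    "(LINT x|\<sigma>. (cmod (rot_field i j p x))\<^sup>2) \<le> (real k)\<^sup>2 * (LINT x|\<sigma>. (cmod (p x))\<^sup>2)" by auto
qed

end


subsection \<open>A majorant series\<close>

text \<open>Newton's binomial series with exponent \<open>- s\<close> at \<open>- q\<close>; the two
  alternating signs cancel.\<close>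

lemma pochhammer_series:
  fixes s q :: real
  assumes "0 \<le> q" "q < 1"
  shows "(\<lambda>p. pochhammer s p / fact p * q ^ p) sums (1 - q) powr (- s)"
proof -
  have "(\<lambda>n. (- s gchoose n) * (- q) ^ n) sums (1 + (- q)) powr (- s)"
    by (rule gen_binomial_real) (use assms in auto)
  moreover have "(- s gchoose n) * (- q) ^ n = pochhammer s n / fact n * q ^ n" for n
  proof -
    have "(- 1) ^ n * (- q) ^ n = q ^ n" by (simp flip: power_mult_distrib)
    then show ?thesis by (simp add: gbinomial_pochhammer)
  qed
  ultimately show ?thesis by simp
qed

text \<open>The point \<open>x + 1\<close> divides the segment from \<open>x\<close> to
  \<open>x + s\<close> with weights \<open>1 - 1 / s\<close> and \<open>1 / s\<close>. Log-convexity
  of Gamma there, with Gamma(x+1) = x Gamma(x), gives the claim after multiplication by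
  \<open>s\<close>.\<close>

lemma Gamma_add_ge_powr:
  fixes x s :: real
  assumes "x > 0" "s \<ge> 1"
  shows "Gamma x * x powr s \<le> Gamma (x + s)"
proof -
  have "(ln \<circ> Gamma) ((1 - 1 / s) *\<^sub>R x + (1 / s) *\<^sub>R (x + s)) \<le> (1 - 1 / s) * (ln \<circ> Gamma) x + (1 / s) * (ln \<circ> Gamma) (x + s)"
    by (rule convex_onD[OF log_convex_Gamma_real]) (use assms in auto)
  moreover have "(1 - 1 / s) *\<^sub>R x + (1 / s) *\<^sub>R (x + s) = x + 1"
    using assms by (simp add: field_simps)
  moreover have "ln (Gamma (x + 1)) = ln x + ln (Gamma x)"
  proof -
    have "x \<notin> \<int>\<^sub>\<le>\<^sub>0" using assms by (auto elim!: nonpos_Ints_cases')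
    then show ?thesis using assms(1) by (subst Gamma_plus1) (auto intro: ln_mult_pos)
  qed
  ultimately have "s * (ln x + ln (Gamma x)) \<le> s * ((1 - 1 / s) * ln (Gamma x) + (1 / s) * ln (Gamma (x + s)))"
    using assms by simp
  also have "\<dots> = s * (ln (Gamma x)) + (ln (Gamma (x + s)) - ln (Gamma x))"
    using assms by (simp add: field_simps)
  finally have "s * ln x + ln (Gamma x) \<le> ln (Gamma (x + s))"
    by (simp add: algebra_simps)
  then have "exp (s * ln x + ln (Gamma x)) \<le> exp (ln (Gamma (x + s)))" by simp
  then show ?thesis
    using assms by (simp add: exp_add powr_def Gamma_real_pos mult.commute)
qed

text \<open>Multiplied by p!, the Pochhammer factor becomes Gamma(p+n+1). The preceding inequality
  absorbs the power into Gamma(p+n+1+s), which is Gamma(c) times \<open>pochhammer c p\<close> for c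
  = n+1+s. Thus the series is dominated termwise by a binomial series.\<close>

lemma pochhammer_powr_sum_le:
  fixes s q :: real and n :: nat
  assumes "0 \<le> q" "q < 1" "s \<ge> 1"
  defines "f \<equiv> \<lambda>p. pochhammer (real (p + 1)) n * real (p + n + 1) powr s * q ^ p"
  shows pochhammer_powr_summable: "summable f"
    and pochhammer_powr_suminf: "suminf f \<le> Gamma (real n + 1 + s) * (1 - q) powr (- (real n + 1 + s))"
proof -
  define c where "c = real n + 1 + s"
  define g where "g = (\<lambda>p. Gamma c * (pochhammer c p / fact p * q ^ p))"
  have c: "c > 0" using assms by (simp add: c_def)
  have g: "g sums (Gamma c * (1 - q) powr (- c))"
    unfolding g_def by (intro sums_mult pochhammer_series assms)
  have f0: "0 \<le> f p" for p
    unfolding f_def using assms by (intro mult_nonneg_nonneg pochhammer_nonneg) auto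
  have fg: "f p \<le> g p" for p
  proof -
    have nonpos: "x > 0 \<Longrightarrow> x \<notin> \<int>\<^sub>\<le>\<^sub>0" for x :: real by (auto elim!: nonpos_Ints_cases')
    have "pochhammer (real (p + 1)) n * fact p = Gamma (real (p + n + 1))"
      using pochhammer_Gamma[of "real (p + 1)" n] Gamma_fact[of p, where ?'a = real] nonpos[of "real (p + 1)"]
      by (simp add: add_ac)
    then have "pochhammer (real (p + 1)) n * fact p * real (p + n + 1) powr s \<le> Gamma (real (p + n + 1) + s)"
      using Gamma_add_ge_powr[of "real (p + n + 1)" s] assms by simp
    also have "real (p + n + 1) + s = c + real p" by (simp add: c_def)
    also have "Gamma (c + real p) = Gamma c * pochhammer c p"
      using pochhammer_Gamma[OF nonpos[OF c], of p] Gamma_real_pos[OF c] by simp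
    finally have "pochhammer (real (p + 1)) n * real (p + n + 1) powr s \<le> Gamma c * (pochhammer c p / fact p)"
      by (simp add: field_simps)
    then show ?thesis
      unfolding f_def g_def mult.assoc[symmetric] using assms by (intro mult_right_mono) auto
  qed
  show sf: "summable f"
    by (rule summable_comparison_test[OF _ sums_summable[OF g]]) (use f0 fg in \<open>auto intro!: exI[of _ 0]\<close>)
  have "suminf f \<le> suminf g" by (rule suminf_le[OF fg sf sums_summable[OF g]])
  then show "suminf f \<le> Gamma (real n + 1 + s) * (1 - q) powr (- (real n + 1 + s))"
    using sums_unique[OF g] by (simp add: c_def)
qed

text \<open>The lower bound lets the binomial absorb the factor m+1 in the estimate of
  \<open>f\<close> itself; the upper bound turns it into a power for the derivatives.\<close>

lemma binomial_growth:
  assumes "d \<ge> 2"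
  shows "m + 1 \<le> (m + d - 1) choose m" and "(m + d - 1) choose m \<le> (m + 1) ^ (d - 1)"
proof -
  \<comment> \<open>The lower bound starts at d = 2, hence two successors; the inductions run over
    the remaining dimension.\<close>
  obtain e where d: "d = Suc (Suc e)" using assms by (metis add_2_eq_Suc le_Suc_ex)
  have ge: "m + 1 \<le> (m + Suc e) choose m" for e
  proof (induction e)
    case (Suc e)
    then show ?case by (cases m) auto
  qed simp
  show "m + 1 \<le> (m + d - 1) choose m" using ge[of e] by (simp add: d)
  have "(m + e) choose m \<le> (m + 1) ^ e" for e
  proof (induction e)
    case (Suc e)
    have "Suc e * ((m + Suc e) choose m) = (m + Suc e) * ((m + e) choose m)"
      using binomial_absorb_comp[of "m + Suc e" m] by simp
    also have "\<dots> \<le> (Suc e * (m + 1)) * (m + 1) ^ e"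
      by (intro mult_mono Suc) auto
    finally have "Suc e * ((m + Suc e) choose m) \<le> Suc e * (m + 1) ^ Suc e"
      by (simp only: power_Suc mult.assoc)
    then show ?case by (simp only: Suc_mult_le_cancel1)
  qed simp
  from this[of "Suc e"] show "(m + d - 1) choose m \<le> (m + 1) ^ (d - 1)" by (simp add: d)
qed

lemma binomial_series:
  fixes q :: real
  assumes "0 \<le> q" "q < 1" "d \<ge> 1"
  shows "(\<lambda>m. real ((m + d - 1) choose m) * q ^ m) sums (1 - q) powi (- int d)"
proof -
  have "real ((m + d - 1) choose m) = pochhammer (real d) m / fact m" for m
  proof -
    have "real ((m + d - 1) choose m) = (real (m + d - 1)) gchoose m" by (simp add: binomial_gbinomial)
    also have "\<dots> = pochhammer (real (m + d - 1) - real m + 1) m / fact m" by (rule gbinomial_pochhammer')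
    also have "real (m + d - 1) - real m + 1 = real d" using assms(3) by simp
    finally show ?thesis .
  qed
  moreover have "(1 - q) powr (- real d) = (1 - q) powi (- int d)"
    using assms by (simp add: powr_minus powr_realpow power_int_minus)
  ultimately show ?thesis using pochhammer_series[OF assms(1,2), of "real d"] by simp
qed


subsection \<open>Termwise differentiation\<close>

text \<open>The derivative of radial projection is the orthogonal projection onto the tangent space,
  scaled by the inverse of the norm.\<close>

lemma has_derivative_sgn:
  fixes x :: "'a::real_inner"
  assumes "x \<noteq> 0"
  shows "(sgn has_derivative (\<lambda>h. (h - (sgn x \<bullet> h) *\<^sub>R sgn x) /\<^sub>R norm x)) (at x)"
proof -
  have nd: "(norm has_derivative (\<lambda>h. sgn x \<bullet> h)) (at x)"
    using has_derivative_norm[OF assms] by (simp add: inner_commute)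
  have "((\<lambda>x. inverse (norm x) *\<^sub>R x) has_derivative
    (\<lambda>h. inverse (norm x) *\<^sub>R h + (- (inverse (norm x) * (sgn x \<bullet> h) * inverse (norm x))) *\<^sub>R x)) (at x)"
    by (rule has_derivative_scaleR[OF Deriv.has_derivative_inverse[OF _ nd] has_derivative_ident]) (use assms in simp)
  moreover have "inverse (norm x) *\<^sub>R h + (- (inverse (norm x) * (sgn x \<bullet> h) * inverse (norm x))) *\<^sub>R x =
    (h - (sgn x \<bullet> h) *\<^sub>R sgn x) /\<^sub>R norm x" for h
    by (simp add: sgn_div_norm scaleR_diff_right mult_ac)
  moreover have "(\<lambda>x::'a. inverse (norm x) *\<^sub>R x) = sgn"
    by (simp add: fun_eq_iff sgn_div_norm)
  ultimately show ?thesis by simp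
qed

text \<open>Contracting the rotation fields with the unit normal \<open>s\<close> produces the j-th
  component of the tangential gradient.\<close>

lemma sum_rot_field_sphere:
  fixes s :: "real ^ 'd"
  assumes "norm s = 1"
  shows "(\<Sum>i\<in>UNIV. of_real (s $ i) * rot_field i j G s) =
    partial_deriv j G s - of_real (s $ j) * (\<Sum>i\<in>UNIV. of_real (s $ i) * partial_deriv i G s)"
proof -
  have "(\<Sum>i\<in>UNIV. s $ i * s $ i) = 1"
    using assms by (simp add: norm_eq_sqrt_inner inner_vec_def)
  then have "(\<Sum>i\<in>UNIV. of_real (s $ i) * of_real (s $ i)) = (1::complex)"
    by (metis (mono_tags, lifting) of_real_1 of_real_mult of_real_sum sum.cong)
  moreover have "(\<Sum>i\<in>UNIV. of_real (s $ i) * rot_field i j G s) =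
    (\<Sum>i\<in>UNIV. of_real (s $ i) * of_real (s $ i)) * partial_deriv j G s
      - of_real (s $ j) * (\<Sum>i\<in>UNIV. of_real (s $ i) * partial_deriv i G s)"
    unfolding rot_field_def sum_distrib_left sum_distrib_right sum_subtractf[symmetric]
    by (intro sum.cong refl) (simp add: algebra_simps)
  ultimately show ?thesis by simp
qed

text \<open>The radial part of the gradient cancels by antisymmetry. This identifies what
  \<open>rot_deriv\<close> computes from the radial extension with \<open>rot_field\<close>.\<close>

lemma rot_field_from_tangential:
  fixes s :: "real ^ 'd"
  assumes "norm s = 1"
  shows "of_real (s $ i) * (\<Sum>a\<in>UNIV. of_real (s $ a) * rot_field a j G s)
    - of_real (s $ j) * (\<Sum>a\<in>UNIV. of_real (s $ a) * rot_field a i G s) = rot_field i j G s"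
  unfolding sum_rot_field_sphere[OF assms] by (simp add: rot_field_def algebra_simps)

text \<open>Only tangential derivatives of \<open>G\<close> enter, so bounds for \<open>rot_field\<close> on the sphere suffice.\<close>

lemma polynomial_function_sgn_line_deriv:
  fixes G :: "real ^ 'd \<Rightarrow> complex"
  assumes "polynomial_function G" "x + t *\<^sub>R axis j 1 \<noteq> 0"
  defines "y \<equiv> x + t *\<^sub>R axis j 1"
  shows "((\<lambda>t. G (sgn (x + t *\<^sub>R axis j 1))) has_vector_derivative
    (\<Sum>i\<in>UNIV. of_real (sgn y $ i) * rot_field i j G (sgn y)) /\<^sub>R norm y) (at t)"
proof -
  have "((\<lambda>x. G (sgn x)) has_derivative
    (\<lambda>h. \<Sum>i\<in>UNIV. ((h - (sgn y \<bullet> h) *\<^sub>R sgn y) /\<^sub>R norm y) $ i *\<^sub>R partial_deriv i G (sgn y))) (at y)"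
    using assms by (intro has_derivative_compose[OF has_derivative_sgn polynomial_function_has_derivative]) auto
  then have "((\<lambda>t. G (sgn (x + t *\<^sub>R axis j 1))) has_derivative
    (\<lambda>h. \<Sum>i\<in>UNIV. ((h *\<^sub>R axis j 1 - (sgn y \<bullet> (h *\<^sub>R axis j 1)) *\<^sub>R sgn y) /\<^sub>R norm y) $ i *\<^sub>R partial_deriv i G (sgn y))) (at t)"
    unfolding y_def
    by (rule has_derivative_compose[rotated]) (auto intro!: derivative_eq_intros)
  moreover have "(\<Sum>i\<in>UNIV. ((h *\<^sub>R axis j 1 - (sgn y \<bullet> (h *\<^sub>R axis j 1)) *\<^sub>R sgn y) /\<^sub>R norm y) $ i *\<^sub>R partial_deriv i G (sgn y))
    = h *\<^sub>R ((\<Sum>i\<in>UNIV. of_real (sgn y $ i) * rot_field i j G (sgn y)) /\<^sub>R norm y)" for h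
  proof -
    have comp: "((h *\<^sub>R axis j 1 - (sgn y \<bullet> (h *\<^sub>R axis j 1)) *\<^sub>R sgn y) /\<^sub>R norm y) $ i =
      (h / norm y) * ((if i = j then 1 else 0) - sgn y $ j * sgn y $ i)" for i
    proof -
      have "(axis j 1 :: real ^ 'd) $ i = (if i = j then 1 else 0)" by (simp add: axis_def)
      then show ?thesis by (simp add: inner_axis divide_inverse algebra_simps)
    qed
    have "(\<Sum>i\<in>UNIV. ((h *\<^sub>R axis j 1 - (sgn y \<bullet> (h *\<^sub>R axis j 1)) *\<^sub>R sgn y) /\<^sub>R norm y) $ i *\<^sub>R partial_deriv i G (sgn y))
      = (\<Sum>i\<in>UNIV. of_real (h / norm y) * ((if i = j then partial_deriv i G (sgn y) else 0)
           - of_real (sgn y $ j) * (of_real (sgn y $ i) * partial_deriv i G (sgn y))))"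
      unfolding comp by (intro sum.cong refl) (simp add: scaleR_conv_of_real algebra_simps)
    also have "\<dots> = of_real (h / norm y) * (partial_deriv j G (sgn y)
           - of_real (sgn y $ j) * (\<Sum>i\<in>UNIV. of_real (sgn y $ i) * partial_deriv i G (sgn y)))"
      by (simp only: sum_subtractf flip: sum_distrib_left) simp
    also have "\<dots> = h *\<^sub>R ((\<Sum>i\<in>UNIV. of_real (sgn y $ i) * rot_field i j G (sgn y)) /\<^sub>R norm y)"
      using assms by (subst sum_rot_field_sphere) (auto simp: norm_sgn scaleR_conv_of_real divide_inverse)
    finally show ?thesis .
  qed
  ultimately show ?thesis by (simp add: has_vector_derivative_def)
qed

text \<open>Termwise differentiation along the line through \<open>\<theta>\<close> in direction
  \<open>j\<close>: the derivatives of the terms converge uniformly near \<open>t = 0\<close> by the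
  Weierstrass M-test.\<close>

lemma power_series_partial_deriv:
  fixes A :: "nat \<Rightarrow> real ^ 'd \<Rightarrow> complex"
  assumes poly: "\<And>m. polynomial_function (A m)"
    and bound: "\<And>i m x. norm x = 1 \<Longrightarrow> cmod (rot_field i j (A m) x) \<le> M m"
    and M: "summable (\<lambda>m. M m * cmod \<zeta> ^ m)"
    and F: "\<And>x. norm x = 1 \<Longrightarrow> (\<lambda>m. A m x * \<zeta> ^ m) sums F x"
    and \<theta>: "norm \<theta> = 1"
  shows "(\<lambda>m. (\<Sum>i\<in>UNIV. of_real (\<theta> $ i) * rot_field i j (A m) \<theta>) * \<zeta> ^ m) sums partial_deriv j (\<lambda>x. F (sgn x)) \<theta>"
proof -
  \<comment> \<open>Radius 1/2 keeps the line at distance at least 1/2 from the origin, where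
    \<open>sgn\<close> is not differentiable.\<close>
  define S where "S = ball (0::real) (1/2)"
  define y where "y = (\<lambda>t. \<theta> + t *\<^sub>R axis j 1 :: real ^ 'd)"
  define u where "u = (\<lambda>m t. ((\<Sum>i\<in>UNIV. of_real (sgn (y t) $ i) * rot_field i j (A m) (sgn (y t))) /\<^sub>R norm (y t)) * \<zeta> ^ m)"
  have ny: "norm (y t) \<ge> 1/2" if "t \<in> S" for t
  proof -
    have "norm \<theta> \<le> norm (y t) + norm (t *\<^sub>R axis j 1 :: real ^ 'd)"
      unfolding y_def by (metis add_diff_cancel_right' norm_triangle_ineq4)
    then show ?thesis using that \<theta> by (simp add: S_def norm_axis_1)
  qed
  have y0: "y t \<noteq> 0" if "t \<in> S" for t using ny[OF that] by auto
  \<comment> \<open>The factor 2 bounds the inverse of the norm of \<open>y t\<close>; the factor d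
    counts the summands of the contraction.\<close>
  have u_bound: "norm (u m t) \<le> 2 * real CARD('d) * (M m * cmod \<zeta> ^ m)" if "t \<in> S" for m t
  proof -
    have s1: "norm (sgn (y t)) = 1" using y0[OF that] by (simp add: norm_sgn)
    have "cmod (\<Sum>i\<in>UNIV. of_real (sgn (y t) $ i) * rot_field i j (A m) (sgn (y t))) \<le> (\<Sum>i\<in>(UNIV::'d set). 1 * M m)"
    proof (intro sum_norm_le)
      fix i
      have "\<bar>sgn (y t) $ i\<bar> \<le> 1" using component_le_norm_cart[of "sgn (y t)" i] s1 by simp
      then show "cmod (of_real (sgn (y t) $ i) * rot_field i j (A m) (sgn (y t))) \<le> 1 * M m"
        unfolding norm_mult norm_of_real using bound[OF s1] by (intro mult_mono) auto
    qed
    moreover have "inverse (norm (y t)) \<le> 2"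
      using le_imp_inverse_le[OF ny[OF that]] by simp
    ultimately have "inverse (norm (y t)) * cmod (\<Sum>i\<in>UNIV. of_real (sgn (y t) $ i) * rot_field i j (A m) (sgn (y t)))
        * cmod \<zeta> ^ m \<le> 2 * (real CARD('d) * M m) * cmod \<zeta> ^ m"
      by (intro mult_right_mono mult_mono) auto
    then show ?thesis
      by (simp add: u_def norm_mult norm_power divide_inverse mult_ac)
  qed
  have uniform: "uniform_limit S (\<lambda>n t. \<Sum>m<n. u m t) (\<lambda>t. \<Sum>m. u m t) sequentially"
    by (rule Weierstrass_m_test[OF u_bound]) (auto intro: summable_mult M)
  have s0: "0 \<in> S" by (simp add: S_def)
  have summ: "summable (\<lambda>m. u m 0)"
    by (rule summable_comparison_test'[OF summable_mult[OF M] u_bound[OF s0]])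
  have "\<exists>g. \<forall>t\<in>S. (\<lambda>m. A m (sgn (y t)) * \<zeta> ^ m) sums g t \<and> (g has_derivative (\<lambda>h. h *\<^sub>R (\<Sum>m. u m t))) (at t within S)"
  proof (rule has_derivative_series)
    show "convex S" by (simp add: S_def)
    show "((\<lambda>t. A m (sgn (y t)) * \<zeta> ^ m) has_derivative (\<lambda>h. h *\<^sub>R u m t)) (at t within S)" if "t \<in> S" for m t
    proof -
      have "((\<lambda>t. A m (sgn (y t))) has_vector_derivative
        (\<Sum>i\<in>UNIV. of_real (sgn (y t) $ i) * rot_field i j (A m) (sgn (y t))) /\<^sub>R norm (y t)) (at t)"
        using polynomial_function_sgn_line_deriv[OF poly, of \<theta> t j m] y0[OF that] by (simp add: y_def)
      then have "((\<lambda>t. A m (sgn (y t)) * \<zeta> ^ m) has_vector_derivative u m t) (at t)"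
        unfolding u_def by (rule has_vector_derivative_mult_left)
      then show ?thesis
        unfolding has_vector_derivative_def by (rule has_derivative_at_withinI)
    qed
    show "\<forall>\<^sub>F n in sequentially. \<forall>t\<in>S. \<forall>h. norm ((\<Sum>m<n. h *\<^sub>R u m t) - h *\<^sub>R (\<Sum>m. u m t)) \<le> e * norm h"
      if "e > 0" for e
    proof (rule eventually_mono[OF uniform_limitD[OF uniform that]], intro ballI allI)
      fix n t and h :: real
      assume "\<forall>t\<in>S. dist (\<Sum>m<n. u m t) (\<Sum>m. u m t) < e" "t \<in> S"
      then have "norm ((\<Sum>m<n. u m t) - (\<Sum>m. u m t)) \<le> e" by (auto simp: dist_norm)
      then have "\<bar>h\<bar> * norm ((\<Sum>m<n. u m t) - (\<Sum>m. u m t)) \<le> \<bar>h\<bar> * e"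
        by (rule mult_left_mono) simp
      then show "norm ((\<Sum>m<n. h *\<^sub>R u m t) - h *\<^sub>R (\<Sum>m. u m t)) \<le> e * norm h"
        by (simp add: mult.commute flip: scaleR_sum_right scaleR_diff_right)
    qed
    show "0 \<in> S" by (rule s0)
    show "(\<lambda>m. A m (sgn (y 0)) * \<zeta> ^ m) sums F (sgn (y 0))"
      by (rule F) (use y0[OF s0] in \<open>simp add: norm_sgn\<close>)
  qed
  then obtain g where g: "\<And>t. t \<in> S \<Longrightarrow> (\<lambda>m. A m (sgn (y t)) * \<zeta> ^ m) sums g t"
    "\<And>t. t \<in> S \<Longrightarrow> (g has_derivative (\<lambda>h. h *\<^sub>R (\<Sum>m. u m t))) (at t within S)" by blast
  \<comment> \<open>The limit function from the series theorem is known only through its series;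
    uniqueness of sums identifies it with \<open>F\<close> on the projected line.\<close>
  have gF: "g t = F (sgn (y t))" if "t \<in> S" for t
    using g(1)[OF that] F[of "sgn (y t)"] y0[OF that] sums_unique2 by (auto simp: norm_sgn)
  have "(g has_derivative (\<lambda>h. h *\<^sub>R (\<Sum>m. u m 0))) (at 0)"
    using g(2)[OF s0] s0 at_within_open[of 0 S] by (simp add: S_def)
  then have "((\<lambda>t. F (sgn (y t))) has_derivative (\<lambda>h. h *\<^sub>R (\<Sum>m. u m 0))) (at 0)"
    by (rule has_derivative_transform_within_open[where s=S]) (use s0 gF in \<open>auto simp: S_def\<close>)
  then have "((\<lambda>t. F (sgn (\<theta> + t *\<^sub>R axis j 1))) has_vector_derivative (\<Sum>m. u m 0)) (at 0)"
    by (simp add: has_vector_derivative_def y_def)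
  then have "partial_deriv j (\<lambda>x. F (sgn x)) \<theta> = (\<Sum>m. u m 0)"
    unfolding partial_deriv_def by (rule vector_derivative_at)
  moreover have "sgn (y 0) = \<theta>" "norm (y 0) = 1" using \<theta> by (simp_all add: y_def sgn_div_norm)
  ultimately show ?thesis
    using summable_sums[OF summ] by (simp add: u_def)
qed

lemma power_series_rot_deriv:
  fixes A :: "nat \<Rightarrow> real ^ 'd \<Rightarrow> complex"
  assumes poly: "\<And>m. polynomial_function (A m)"
    and bound: "\<And>i j m x. norm x = 1 \<Longrightarrow> cmod (rot_field i j (A m) x) \<le> M m"
    and M: "summable (\<lambda>m. M m * cmod \<zeta> ^ m)"
    and F: "\<And>x. norm x = 1 \<Longrightarrow> (\<lambda>m. A m x * \<zeta> ^ m) sums F \<zeta> x"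
    and \<theta>: "norm \<theta> = 1"
  shows "(\<lambda>m. rot_field i j (A m) \<theta> * \<zeta> ^ m) sums rot_deriv i j F \<zeta> \<theta>"
proof -
  note s = power_series_partial_deriv[OF poly bound M F \<theta>]
  have "(\<lambda>m. of_real (\<theta> $ i) * ((\<Sum>a\<in>UNIV. of_real (\<theta> $ a) * rot_field a j (A m) \<theta>) * \<zeta> ^ m)
      - of_real (\<theta> $ j) * ((\<Sum>a\<in>UNIV. of_real (\<theta> $ a) * rot_field a i (A m) \<theta>) * \<zeta> ^ m)) sums rot_deriv i j F \<zeta> \<theta>"
    unfolding rot_deriv_def by (intro sums_diff sums_mult s)
  moreover have "of_real (\<theta> $ i) * ((\<Sum>a\<in>UNIV. of_real (\<theta> $ a) * rot_field a j (A m) \<theta>) * \<zeta> ^ m)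
      - of_real (\<theta> $ j) * ((\<Sum>a\<in>UNIV. of_real (\<theta> $ a) * rot_field a i (A m) \<theta>) * \<zeta> ^ m)
      = rot_field i j (A m) \<theta> * \<zeta> ^ m" for m
    unfolding rot_field_from_tangential[OF \<theta>, of i j "A m", symmetric] by (simp add: algebra_simps)
  ultimately show ?thesis by simp
qed

lemma power_series_zeta_deriv:
  assumes F: "\<And>w. cmod w < 1 \<Longrightarrow> (\<lambda>m. a m * w ^ m) sums F w \<theta>" and "cmod \<zeta> < 1"
  shows "(\<lambda>m. of_nat (Suc m) * a (Suc m) * \<zeta> ^ m) sums zeta_deriv F \<zeta> \<theta>"
proof -
  have "((\<lambda>w. \<Sum>m. a m * w ^ m) has_field_derivative (\<Sum>m. diffs a m * \<zeta> ^ m)) (at \<zeta>)"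
    by (rule termdiffs_strong'[where K = 1]) (use F sums_summable assms(2) in auto)
  then have d: "((\<lambda>w. F w \<theta>) has_field_derivative (\<Sum>m. diffs a m * \<zeta> ^ m)) (at \<zeta>)"
    by (rule has_field_derivative_transform_within_open[where S = "ball 0 1"])
       (use assms(2) sums_unique[OF F] in auto)
  from termdiffs_sums_strong[OF F d assms(2)] DERIV_imp_deriv[OF d]
  show ?thesis by (simp add: zeta_deriv_def diffs_def)
qed


subsection \<open>Mixed derivatives of Hardy functions\<close>

lemma rot_field_sum_scaleR:
  fixes p :: "'a \<Rightarrow> real ^ 'd \<Rightarrow> complex"
  assumes "\<And>s. s \<in> A \<Longrightarrow> polynomial_function (p s)"
  shows "rot_field i j (\<lambda>x. \<Sum>s\<in>A. r s *\<^sub>R p s x) = (\<lambda>x. \<Sum>s\<in>A. r s *\<^sub>R rot_field i j (p s) x)"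
  using assms
  by (simp add: rot_field_def fun_eq_iff partial_deriv_sum_scaleR sum_distrib_left sum_subtractf
      scaleR_right_diff_distrib)

text \<open>The head of the list acts last, as in \<open>mixed_deriv\<close>.\<close>

definition iter_rot_field :: "('d::finite \<times> 'd) list \<Rightarrow> (real ^ 'd \<Rightarrow> complex) \<Rightarrow> real ^ 'd \<Rightarrow> complex" where
  "iter_rot_field = foldr (\<lambda>(i, j). rot_field i j)"

lemma iter_rot_field_simps [simp]:
  "iter_rot_field [] p = p"
  "iter_rot_field ((i, j) # R) p = rot_field i j (iter_rot_field R p)"
  by (simp_all add: iter_rot_field_def)

lemma power_le_pochhammer: "0 \<le> x \<Longrightarrow> x ^ n \<le> pochhammer x n" for x :: real
proof (induction n)
  case (Suc n)
  then have "x ^ n * x \<le> pochhammer x n * (x + real n)"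
    by (intro mult_mono order_trans[OF zero_le_power Suc.IH]) auto
  then show ?case by (simp add: pochhammer_rec' mult.commute)
qed simp

text \<open>Bounds the p-th coefficient of a mixed derivative of order \<open>n\<close>, relative to
  the norm of \<open>f\<close>, however the order splits into complex and rotational
  derivatives.\<close>

definition majorant :: "nat \<Rightarrow> nat \<Rightarrow> nat \<Rightarrow> real" where
  "majorant d n p = pochhammer (real (p + 1)) n * real (p + n + 1) powr (real d / 2)"

lemma majorant_series:
  assumes "0 \<le> q" "q < 1" "d \<ge> 2"
  shows majorant_summable: "summable (\<lambda>p. majorant d n p * q ^ p)"
    and majorant_suminf: "(\<Sum>p. majorant d n p * q ^ p) \<le> Gamma (real n + 1 + real d / 2)
      * (1 - q) powr (- (real n + 1 + real d / 2))"
  using pochhammer_powr_summable[OF assms(1,2), of "real d / 2" n]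
    pochhammer_powr_suminf[OF assms(1,2), of "real d / 2" n] assms(3)
  by (simp_all add: majorant_def)

context sphere_harmonics
begin

text \<open>Monotonicity in the degree gives one bound for all harmonic components of degrees m, m -
  2, and so on.\<close>

lemma harmonic_dim_le_binomial:
  assumes "k \<le> m"
  shows "harmonic_dim TYPE('d) k \<le> ((m + CARD('d) - 1) choose m)"
proof -
  have eq: "((k + CARD('d) - 1) choose k) = (k + (CARD('d) - 1)) choose (CARD('d) - 1)" for k
    using card_ge_2 binomial_symmetric[of k "k + (CARD('d) - 1)"] by simp
  show ?thesis
    using harmonic_dim_le[where 'd='d, of k] binomial_right_mono[of "k + (CARD('d) - 1)" "m + (CARD('d) - 1)" "CARD('d) - 1"] assms
    unfolding eq by linarith
qed

text \<open>Each field stays in \<open>harmonic_polys k\<close>, so it can be applied again and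
  costs a factor \<open>k\<close> each time.\<close>

lemma iter_rot_field_harmonic:
  assumes "p \<in> harmonic_polys k"
  shows iter_rot_field_mem: "iter_rot_field R p \<in> harmonic_polys k"
    and iter_rot_field_L2: "(LINT x|\<sigma>. (cmod (iter_rot_field R p x))\<^sup>2) \<le> (real k ^ length R)\<^sup>2 * (LINT x|\<sigma>. (cmod (p x))\<^sup>2)"
proof -
  have "iter_rot_field R p \<in> harmonic_polys k \<and>
    (LINT x|\<sigma>. (cmod (iter_rot_field R p x))\<^sup>2) \<le> (real k ^ length R)\<^sup>2 * (LINT x|\<sigma>. (cmod (p x))\<^sup>2)"
  proof (induction R)
    case (Cons ij R)
    obtain i j where ij: "ij = (i, j)" by (cases ij)
    have mem: "iter_rot_field R p \<in> harmonic_polys k" using Cons.IH by blast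
    have "(LINT x|\<sigma>. (cmod (rot_field i j (iter_rot_field R p) x))\<^sup>2)
        \<le> (real k)\<^sup>2 * (LINT x|\<sigma>. (cmod (iter_rot_field R p x))\<^sup>2)"
      by (rule rot_field_L2[OF mem])
    also have "\<dots> \<le> (real k)\<^sup>2 * ((real k ^ length R)\<^sup>2 * (LINT x|\<sigma>. (cmod (p x))\<^sup>2))"
      using Cons.IH by (intro mult_left_mono) auto
    finally show ?case
      using rot_field_mem[OF mem] by (simp add: ij power_mult_distrib mult.assoc)
  qed (simp add: assms)
  then show "iter_rot_field R p \<in> harmonic_polys k"
    "(LINT x|\<sigma>. (cmod (iter_rot_field R p x))\<^sup>2) \<le> (real k ^ length R)\<^sup>2 * (LINT x|\<sigma>. (cmod (p x))\<^sup>2)" by auto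
qed

lemma iter_rot_field_sum:
  fixes p :: "nat \<Rightarrow> real ^ 'd \<Rightarrow> complex"
  assumes "\<And>s. s \<in> A \<Longrightarrow> p s \<in> harmonic_polys (k s)"
  shows "iter_rot_field R (\<lambda>x. \<Sum>s\<in>A. p s x) = (\<lambda>x. \<Sum>s\<in>A. iter_rot_field R (p s) x)"
proof (induction R)
  case (Cons ij R)
  obtain i j where ij: "ij = (i, j)" by (cases ij)
  have "polynomial_function (iter_rot_field R (p s))" if "s \<in> A" for s
    using iter_rot_field_mem[OF assms[OF that]] by (simp add: harmonic_polys_def)
  from rot_field_sum_scaleR[of A "\<lambda>s. iter_rot_field R (p s)" i j "\<lambda>_. 1", OF this]
  show ?case by (simp add: ij Cons.IH)
qed simp

lemma iter_rot_field_eval_le: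
  assumes "p \<in> harmonic_polys k" "norm x = 1"
  shows "cmod (iter_rot_field R p x) \<le> sqrt (real (harmonic_dim TYPE('d) k)) * real k ^ length R * sqrt (LINT x|\<sigma>. (cmod (p x))\<^sup>2)"
proof -
  have "(cmod (iter_rot_field R p x))\<^sup>2 \<le> real (harmonic_dim TYPE('d) k) * (LINT x|\<sigma>. (cmod (iter_rot_field R p x))\<^sup>2)"
    by (rule harmonic_eval_le[OF iter_rot_field_mem[OF assms(1)] assms(2)])
  also have "\<dots> \<le> real (harmonic_dim TYPE('d) k) * ((real k ^ length R)\<^sup>2 * (LINT x|\<sigma>. (cmod (p x))\<^sup>2))"
    by (intro mult_left_mono iter_rot_field_L2 assms) auto
  finally have "cmod (iter_rot_field R p x) \<le> sqrt (real (harmonic_dim TYPE('d) k) * ((real k ^ length R)\<^sup>2 * (LINT x|\<sigma>. (cmod (p x))\<^sup>2)))"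
    by (rule real_le_rsqrt)
  then show ?thesis by (simp add: real_sqrt_mult)
qed

end

section \<open>Grouping the expansion of a Hardy function by degree\<close>

text \<open>The coefficient family is a parameter, so the estimates hold for any family representing
  \<open>f\<close>, in particular for the one chosen in \<open>hardy_norm\<close>.\<close>

locale hardy_function = sphere_harmonics \<sigma> Y
  for \<sigma> :: "(real ^ 'd::finite) measure" and Y :: "nat \<Rightarrow> nat \<Rightarrow> real ^ 'd \<Rightarrow> complex" +
  fixes f :: "complex ^ 'd \<Rightarrow> complex" and c :: "nat \<times> nat \<times> nat \<Rightarrow> complex" and coeff_norm :: real
  assumes coeffs: "hardy_coeffs Y f c"
    and coeff_norm_def: "coeff_norm = sqrt (\<Sum>\<^sub>\<infinity>n\<in>hardy_index TYPE('d). (norm (c n))\<^sup>2)"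
begin

lemma coeff_norm_nonneg: "coeff_norm \<ge> 0"
  by (simp add: coeff_norm_def infsum_nonneg)

definition harmonic_part :: "nat \<Rightarrow> nat \<Rightarrow> real ^ 'd \<Rightarrow> complex" where
  "harmonic_part k j x = (\<Sum>l=1..harmonic_dim TYPE('d) k. c (k, l, j) * Y k l x)"

text \<open>The coefficient of \<open>z ^ m\<close>: it collects the pairs with k + 2j = m, and
  \<open>j \<le> m div 2\<close> keeps the natural subtraction exact.\<close>

definition degree_part :: "nat \<Rightarrow> real ^ 'd \<Rightarrow> complex" where
  "degree_part m x = (\<Sum>j\<le>m div 2. harmonic_part (m - 2 * j) j x)"

lemma harmonic_part_mem: "harmonic_part k j \<in> harmonic_polys k"
  unfolding harmonic_part_def[abs_def] by (intro harmonic_polys_sum Y_harmonic)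

lemma iter_rot_field_degree_part:
  "iter_rot_field R (degree_part m) = (\<lambda>x. \<Sum>j\<le>m div 2. iter_rot_field R (harmonic_part (m - 2 * j) j) x)"
  unfolding degree_part_def[abs_def]
  by (rule iter_rot_field_sum[where k="\<lambda>j. m - 2 * j"]) (rule harmonic_part_mem)

lemma polynomial_iter_rot_field_degree_part: "polynomial_function (iter_rot_field R (degree_part m))"
  unfolding iter_rot_field_degree_part
  using iter_rot_field_mem[OF harmonic_part_mem]
  by (intro polynomial_function_sum) (auto simp: harmonic_polys_def)

lemma sum_coeffs_degree_le:
  "(\<Sum>j\<le>m div 2. \<Sum>l=1..harmonic_dim TYPE('d) (m - 2 * j). (cmod (c (m - 2 * j, l, j)))\<^sup>2) \<le> coeff_norm\<^sup>2"
proof -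
  let ?S = "Sigma {..m div 2} (\<lambda>j. {1..harmonic_dim TYPE('d) (m - 2 * j)})"
  let ?g = "\<lambda>(j, l). (m - 2 * j, l, j)"
  have inj: "inj_on ?g ?S" by (auto simp: inj_on_def)
  have "(\<Sum>j\<le>m div 2. \<Sum>l=1..harmonic_dim TYPE('d) (m - 2 * j). (cmod (c (m - 2 * j, l, j)))\<^sup>2)
     = (\<Sum>n\<in>?g ` ?S. (cmod (c n))\<^sup>2)"
    by (subst sum.reindex[OF inj]) (simp add: sum.Sigma split_def)
  also have "\<dots> \<le> (\<Sum>\<^sub>\<infinity>n\<in>hardy_index TYPE('d). (cmod (c n))\<^sup>2)"
    using coeffs by (intro finite_sum_le_infsum) (auto simp: hardy_coeffs_def hardy_index_def)
  finally show ?thesis by (simp add: coeff_norm_def infsum_nonneg)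
qed

text \<open>Each harmonic component is bounded by its L2-norm \<open>h j\<close>. Cauchy-Schwarz
  over the at most m+1 values of \<open>j\<close> then costs the square root of m+1 and leaves a
  finite part of the square sum of the coefficients.\<close>

lemma degree_part_bound:
  assumes "norm x = 1"
  shows "cmod (iter_rot_field R (degree_part m) x) \<le> real m ^ length R * sqrt (real ((m + 1) * ((m + CARD('d) - 1) choose m))) * coeff_norm"
proof -
  define h where "h = (\<lambda>j. sqrt (\<Sum>l=1..harmonic_dim TYPE('d) (m - 2 * j). (cmod (c (m - 2 * j, l, j)))\<^sup>2))"
  have h0: "h j \<ge> 0" for j by (simp add: h_def sum_nonneg)
  have "(\<Sum>j\<le>m div 2. h j)\<^sup>2 \<le> (\<Sum>j\<le>m div 2. 1\<^sup>2) * (\<Sum>j\<le>m div 2. (h j)\<^sup>2)"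
    using Cauchy_Schwarz_ineq_sum[of "\<lambda>_. 1" h "{..m div 2}"] by simp
  also have "\<dots> \<le> real (m + 1) * coeff_norm\<^sup>2"
    using sum_coeffs_degree_le[of m] by (intro mult_mono) (auto simp: h_def sum_nonneg)
  finally have sum_h: "(\<Sum>j\<le>m div 2. h j) \<le> sqrt (real (m + 1)) * coeff_norm"
    using coeff_norm_nonneg real_le_rsqrt by (fastforce simp: real_sqrt_mult)
  have "cmod (iter_rot_field R (degree_part m) x) \<le> (\<Sum>j\<le>m div 2. sqrt (real (((m + CARD('d) - 1) choose m))) * real m ^ length R * h j)"
    unfolding iter_rot_field_degree_part
  proof (rule sum_norm_le)
    fix j
    have "cmod (iter_rot_field R (harmonic_part (m - 2 * j) j) x) \<le>
      sqrt (real (harmonic_dim TYPE('d) (m - 2 * j))) * real (m - 2 * j) ^ length R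
        * sqrt (LINT x|\<sigma>. (cmod (harmonic_part (m - 2 * j) j x))\<^sup>2)"
      by (rule iter_rot_field_eval_le[OF harmonic_part_mem assms])
    also have "sqrt (LINT x|\<sigma>. (cmod (harmonic_part (m - 2 * j) j x))\<^sup>2) = h j"
      unfolding harmonic_part_def L2_norm_expansion h_def ..
    also have "sqrt (real (harmonic_dim TYPE('d) (m - 2 * j))) * real (m - 2 * j) ^ length R * h j \<le>
      sqrt (real ((m + CARD('d) - 1) choose m)) * real m ^ length R * h j"
      using harmonic_dim_le_binomial[of "m - 2 * j" m]
      by (intro mult_right_mono mult_mono power_mono h0) auto
    finally show "cmod (iter_rot_field R (harmonic_part (m - 2 * j) j) x) \<le> sqrt (real (((m + CARD('d) - 1) choose m))) * real m ^ length R * h j" .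
  qed
  also have "\<dots> = sqrt (real (((m + CARD('d) - 1) choose m))) * real m ^ length R * (\<Sum>j\<le>m div 2. h j)"
    by (rule sum_distrib_left[symmetric])
  also have "\<dots> \<le> sqrt (real (((m + CARD('d) - 1) choose m))) * real m ^ length R * (sqrt (real (m + 1)) * coeff_norm)"
    by (intro mult_left_mono sum_h) auto
  also have "\<dots> = real m ^ length R * sqrt (real ((m + 1) * ((m + CARD('d) - 1) choose m))) * coeff_norm"
    by (simp only: of_nat_mult real_sqrt_mult mult_ac)
  finally show ?thesis .
qed

text \<open>The expansion converges unconditionally, so it may be regrouped along k + 2j = m; each
  group is finite.\<close>

lemma degree_part_sums:
  assumes "cmod z < 1" "norm x = 1"
  shows "(\<lambda>m. degree_part m x * z ^ m) sums f (klein_dirac_point z x)"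
proof -
  let ?S = "\<lambda>m. Sigma {..m div 2} (\<lambda>j. {1..harmonic_dim TYPE('d) (m - 2 * j)})"
  let ?h = "\<lambda>(m, j, l). c (m - 2 * j, l, j) * z ^ m * Y (m - 2 * j) l x"
  have "((\<lambda>(k, l, j). c (k, l, j) * z ^ (k + 2 * j) * Y k l x) has_sum f (klein_dirac_point z x)) (hardy_index TYPE('d))"
    using coeffs assms by (simp add: hardy_coeffs_def)
  also have "?this \<longleftrightarrow> (?h has_sum f (klein_dirac_point z x)) (Sigma UNIV ?S)"
    by (rule has_sum_reindex_bij_witness[where i="\<lambda>(m, j, l). (m - 2 * j, l, j)" and j="\<lambda>(k, l, j). (k + 2 * j, j, l)"])
       (auto simp: hardy_index_def)
  finally have "(?h has_sum f (klein_dirac_point z x)) (Sigma UNIV ?S)" .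
  then have "((\<lambda>m. degree_part m x * z ^ m) has_sum f (klein_dirac_point z x)) UNIV"
  proof (rule has_sum_SigmaD)
    fix m
    have "(\<Sum>(j, l)\<in>?S m. c (m - 2 * j, l, j) * z ^ m * Y (m - 2 * j) l x) = degree_part m x * z ^ m"
      by (subst sum.Sigma[symmetric])
         (simp_all add: degree_part_def harmonic_part_def sum_distrib_left sum_distrib_right mult_ac)
    then show "((\<lambda>y. ?h (m, y)) has_sum (degree_part m x * z ^ m)) (?S m)"
      by (subst has_sum_finite_iff) (auto simp: split_def)
  qed
  then show ?thesis by (rule has_sum_imp_sums)
qed

section \<open>Power series of mixed derivatives\<close>

definition deriv_coeff :: "nat \<Rightarrow> ('d \<times> 'd) list \<Rightarrow> nat \<Rightarrow> real ^ 'd \<Rightarrow> complex" where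
  "deriv_coeff a R p x = pochhammer (real (p + 1)) a *\<^sub>R iter_rot_field R (degree_part (p + a)) x"

lemma polynomial_deriv_coeff: "polynomial_function (deriv_coeff a R p)"
  unfolding deriv_coeff_def[abs_def] by (intro polynomial_function_cmul polynomial_iter_rot_field_degree_part)

lemma rot_field_deriv_coeff: "rot_field i j (deriv_coeff a R p) = deriv_coeff a ((i, j) # R) p"
  using rot_field_sum_scaleR[of "{p}" "\<lambda>p. iter_rot_field R (degree_part (p + a))" i j "\<lambda>p. pochhammer (real (p + 1)) a"]
    polynomial_iter_rot_field_degree_part
  by (simp add: deriv_coeff_def[abs_def])

lemma deriv_coeff_Suc: "of_nat (Suc p) * deriv_coeff a R (Suc p) x = deriv_coeff (Suc a) R p x"
  by (simp add: deriv_coeff_def pochhammer_rec scaleR_conv_of_real add_ac)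

text \<open>The rotations cost m^b with m = p+a, which is at most (m+1)...(m+b) and so prolongs
  (p+1)...(p+a) to (p+1)...(p+n). The square root of the binomial factor is at most (m+1)^(d/2), and
  m \<le> p+n removes the dependence on \<open>a\<close>.\<close>

lemma deriv_coeff_bound:
  assumes "norm x = 1"
  shows "cmod (deriv_coeff a R p x) \<le> coeff_norm * majorant CARD('d) (a + length R) p"
proof -
  let ?m = "p + a" and ?n = "a + length R" and ?d = "CARD('d)"
  have "(?m + 1) * ((?m + CARD('d) - 1) choose ?m) \<le> (?m + 1) * (?m + 1) ^ (?d - 1)"
    by (intro mult_left_mono binomial_growth(2) card_ge_2) auto
  also have "\<dots> = (?m + 1) ^ ?d" using card_ge_2 by (simp flip: power_Suc)
  finally have "sqrt (real ((?m + 1) * ((?m + CARD('d) - 1) choose ?m))) \<le> sqrt (real ((?m + 1) ^ ?d))"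
    by (simp only: real_sqrt_le_iff of_nat_le_iff)
  also have "\<dots> = real (?m + 1) powr (real ?d / 2)"
    by (simp add: powr_half_sqrt[symmetric] powr_powr flip: powr_realpow)
  also have "\<dots> \<le> real (p + ?n + 1) powr (real ?d / 2)"
    by (intro powr_mono2) auto
  finally have growth: "sqrt (real ((?m + 1) * ((?m + CARD('d) - 1) choose ?m))) \<le> real (p + ?n + 1) powr (real ?d / 2)" .
  have "real ?m ^ length R \<le> real (?m + 1) ^ length R" by (intro power_mono) auto
  also have "\<dots> \<le> pochhammer (real (?m + 1)) (length R)" by (rule power_le_pochhammer) simp
  finally have "pochhammer (real (p + 1)) a * real ?m ^ length R \<le> pochhammer (real (p + 1)) a * pochhammer (real (?m + 1)) (length R)"
    by (intro mult_left_mono pochhammer_nonneg) auto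
  also have "\<dots> = pochhammer (real (p + 1)) ?n"
    using pochhammer_product'[of "real (p + 1)" a "length R"] by (simp add: add_ac)
  finally have poch: "pochhammer (real (p + 1)) a * real ?m ^ length R \<le> pochhammer (real (p + 1)) ?n" .
  have "cmod (deriv_coeff a R p x) = pochhammer (real (p + 1)) a * cmod (iter_rot_field R (degree_part ?m) x)"
    by (simp add: deriv_coeff_def pochhammer_nonneg)
  also have "\<dots> \<le> pochhammer (real (p + 1)) a * (real ?m ^ length R * sqrt (real ((?m + 1) * ((?m + CARD('d) - 1) choose ?m))) * coeff_norm)"
    by (intro mult_left_mono degree_part_bound assms pochhammer_nonneg) auto
  also have "\<dots> = (pochhammer (real (p + 1)) a * real ?m ^ length R) * sqrt (real ((?m + 1) * ((?m + CARD('d) - 1) choose ?m))) * coeff_norm"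
    by (simp only: mult_ac)
  also have "\<dots> \<le> pochhammer (real (p + 1)) ?n * real (p + ?n + 1) powr (real ?d / 2) * coeff_norm"
    by (intro mult_mono growth poch coeff_norm_nonneg mult_nonneg_nonneg pochhammer_nonneg) auto
  finally show ?thesis by (simp only: majorant_def mult_ac)
qed

lemma deriv_coeff_summable:
  assumes "0 \<le> q" "q < 1"
  shows "summable (\<lambda>p. (coeff_norm * majorant CARD('d) n p) * q ^ p)"
  unfolding mult.assoc by (intro summable_mult majorant_summable assms card_ge_2)

lemma mixed_deriv_series:
  assumes "Ds \<in> lists (insert zeta_deriv (range (\<lambda>(i, j). rot_deriv i j)))"
  shows "\<exists>a R. a + length R = length Ds \<and>
    (\<forall>z x. cmod z < 1 \<longrightarrow> norm x = 1 \<longrightarrow>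
      (\<lambda>p. deriv_coeff a R p x * z ^ p) sums mixed_deriv Ds (\<lambda>w \<eta>. f (klein_dirac_point w \<eta>)) z x)"
  using assms
proof (induction Ds)
  case Nil
  show ?case
    by (intro exI[of _ 0] exI[of _ "[]"])
       (auto simp: mixed_deriv_def deriv_coeff_def intro: degree_part_sums)
next
  case (Cons D Ds)
  define F where "F = mixed_deriv Ds (\<lambda>w \<eta>. f (klein_dirac_point w \<eta>))"
  obtain a R where aR: "a + length R = length Ds"
    and F: "\<And>z x. cmod z < 1 \<Longrightarrow> norm x = 1 \<Longrightarrow> (\<lambda>p. deriv_coeff a R p x * z ^ p) sums F z x"
    using Cons by (auto simp: F_def)
  have step: "mixed_deriv (D # Ds) (\<lambda>w \<eta>. f (klein_dirac_point w \<eta>)) = D F"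
    by (simp add: mixed_deriv_def F_def)
  consider "D = zeta_deriv" | i j where "D = rot_deriv i j"
    using Cons.hyps by auto
  then show ?case
  proof cases
    case 1
    have "(\<lambda>p. deriv_coeff (Suc a) R p x * z ^ p) sums D F z x" if "cmod z < 1" "norm x = 1" for z x
      using power_series_zeta_deriv[of "\<lambda>p. deriv_coeff a R p x" F x z] F that
      unfolding deriv_coeff_Suc 1 by blast
    with aR show ?thesis
      unfolding step by (intro exI[of _ "Suc a"] exI[of _ R]) auto
  next
    case 2
    have "(\<lambda>p. deriv_coeff a ((i, j) # R) p x * z ^ p) sums D F z x" if "cmod z < 1" "norm x = 1" for z x
    proof -
      \<comment> \<open>The coefficient bound for the list extended by \<open>(i, j)\<close>
        provides the majorant that permits differentiation under the sum.\<close>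
      have "cmod (rot_field i j (deriv_coeff a R p) x) \<le> coeff_norm * majorant CARD('d) (Suc (a + length R)) p"
        if "norm x = 1" for i j p x
        using deriv_coeff_bound[OF that, of a "(i, j) # R" p] by (simp add: rot_field_deriv_coeff)
      then have "(\<lambda>p. rot_field i j (deriv_coeff a R p) x * z ^ p) sums rot_deriv i j F z x"
        by (rule power_series_rot_deriv[OF polynomial_deriv_coeff _ deriv_coeff_summable]) (use that F in auto)
      then show ?thesis by (simp add: rot_field_deriv_coeff 2)
    qed
    with aR show ?thesis
      unfolding step by (intro exI[of _ a] exI[of _ "(i, j) # R"]) auto
  qed
qed

section \<open>The bounds for the function and its derivatives\<close>

lemma function_bound:
  assumes "0 < q" "q < 1" "cmod z \<le> q" "norm x = 1"
  shows "cmod (f (klein_dirac_point z x)) \<le> (1 - q) powi (- int CARD('d)) * coeff_norm"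
proof -
  let ?B = "\<lambda>m. real ((m + CARD('d) - 1) choose m)"
  have B: "(\<lambda>m. ?B m * q ^ m * coeff_norm) sums ((1 - q) powi (- int CARD('d)) * coeff_norm)"
    using assms card_ge_2 by (intro sums_mult2 binomial_series) auto
  have le: "cmod (degree_part m x * z ^ m) \<le> ?B m * q ^ m * coeff_norm" for m
  proof -
    \<comment> \<open>As m+1 is at most the binomial, their geometric mean is at most the binomial
      too, and this gives exactly the Taylor coefficients of the claimed bound.\<close>
    have "(m + 1) * ((m + CARD('d) - 1) choose m) \<le> ((m + CARD('d) - 1) choose m)\<^sup>2"
      unfolding power2_eq_square by (intro mult_right_mono binomial_growth(1) card_ge_2) auto
    then have "sqrt (real ((m + 1) * ((m + CARD('d) - 1) choose m))) \<le> sqrt (real (((m + CARD('d) - 1) choose m)\<^sup>2))"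
      by (simp only: real_sqrt_le_iff of_nat_le_iff)
    then have sq: "sqrt (real ((m + 1) * ((m + CARD('d) - 1) choose m))) \<le> ?B m"
      by (simp only: of_nat_power real_sqrt_abs abs_of_nat)
    have "cmod (degree_part m x) \<le> sqrt (real ((m + 1) * ((m + CARD('d) - 1) choose m))) * coeff_norm"
      using degree_part_bound[OF assms(4), of "[]" m] by simp
    also have "\<dots> \<le> ?B m * coeff_norm"
      by (intro mult_right_mono sq coeff_norm_nonneg)
    finally have "cmod (degree_part m x) * cmod z ^ m \<le> ?B m * coeff_norm * q ^ m"
      using assms coeff_norm_nonneg by (intro mult_mono power_mono) auto
    then show ?thesis by (simp add: norm_mult norm_power mult_ac)
  qed
  have s: "(\<lambda>m. degree_part m x * z ^ m) sums f (klein_dirac_point z x)"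
    using assms by (intro degree_part_sums) auto
  have "norm (\<Sum>m. degree_part m x * z ^ m) \<le> (\<Sum>m. ?B m * q ^ m * coeff_norm)"
    by (rule norm_suminf_le[OF le sums_summable[OF B]])
  then show ?thesis using sums_unique[OF s] sums_unique[OF B] by simp
qed

lemma mixed_deriv_bound:
  assumes "Ds \<in> lists (insert zeta_deriv (range (\<lambda>(i, j). rot_deriv i j)))" "length Ds \<ge> 1"
    and "0 < q" "q < 1" "cmod z \<le> q" "norm x = 1"
  shows "cmod (mixed_deriv Ds (\<lambda>w \<eta>. f (klein_dirac_point w \<eta>)) z x)
    \<le> Gamma (real CARD('d) / 2) * (1 - q) powi (- int CARD('d) - int (length Ds))
       * (\<Prod>i = 0..length Ds. real CARD('d) / 2 + real i) * real (length Ds) * coeff_norm"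
proof -
  define n where "n = length Ds"
  define d where "d = real CARD('d)"
  have d2: "d \<ge> 2" using card_ge_2 by (simp add: d_def)
  have n1: "real n \<ge> 1" using assms(2) by (simp add: n_def)
  obtain a R where aR: "a + length R = n"
    and s: "(\<lambda>p. deriv_coeff a R p x * z ^ p) sums mixed_deriv Ds (\<lambda>w \<eta>. f (klein_dirac_point w \<eta>)) z x"
    using mixed_deriv_series[OF assms(1)] assms by (force simp: n_def)
  have le: "cmod (deriv_coeff a R p x * z ^ p) \<le> coeff_norm * (majorant CARD('d) n p * q ^ p)" for p
  proof -
    have "cmod (deriv_coeff a R p x) * cmod z ^ p \<le> coeff_norm * majorant CARD('d) n p * q ^ p"
      using deriv_coeff_bound[OF assms(6), of a R p] assms unfolding aR
      by (intro mult_mono power_mono) (auto intro: order_trans[OF norm_ge_zero])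
    then show ?thesis by (simp add: norm_mult norm_power mult.assoc)
  qed
  have summ: "summable (\<lambda>p. majorant CARD('d) n p * q ^ p)"
    using assms by (intro majorant_summable card_ge_2) auto
  have "cmod (mixed_deriv Ds (\<lambda>w \<eta>. f (klein_dirac_point w \<eta>)) z x) \<le> (\<Sum>p. coeff_norm * (majorant CARD('d) n p * q ^ p))"
    unfolding sums_unique[OF s] by (rule norm_suminf_le[OF le summable_mult[OF summ]])
  also have "\<dots> = coeff_norm * (\<Sum>p. majorant CARD('d) n p * q ^ p)"
    by (rule suminf_mult[OF summ])
  also have "\<dots> \<le> coeff_norm * (Gamma (real n + 1 + d / 2) * (1 - q) powr (- (real n + 1 + d / 2)))"
    unfolding d_def using assms by (intro mult_left_mono majorant_suminf card_ge_2 coeff_norm_nonneg) auto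
  \<comment> \<open>The functional equation, used n+1 times, splits off the product in the claim;
    what remains, \<open>Gamma (d / 2)\<close>, depends on the dimension only.\<close>
  also have "Gamma (real n + 1 + d / 2) = Gamma (d / 2) * (\<Prod>i = 0..n. d / 2 + real i)"
  proof -
    have "d / 2 \<notin> \<int>\<^sub>\<le>\<^sub>0" using d2 by (auto elim!: nonpos_Ints_cases')
    moreover from this have Gamma_nz: "Gamma (d / 2) \<noteq> 0" by (simp add: Gamma_eq_zero_iff)
    ultimately have "pochhammer (d / 2) (Suc n) = Gamma (d / 2 + of_nat (Suc n)) / Gamma (d / 2)"
      by (intro pochhammer_Gamma)
    then have "Gamma (d / 2 + real (Suc n)) = Gamma (d / 2) * pochhammer (d / 2) (Suc n)"
      using Gamma_nz by (simp add: field_simps)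
    then show ?thesis by (simp add: pochhammer_Suc_prod add_ac)
  qed
  \<comment> \<open>The exponent may be enlarged because d \<ge> 2 gives 1 + d/2 \<le> d and the
    base lies below 1.\<close>
  also have "(1 - q) powr (- (real n + 1 + d / 2)) \<le> (1 - q) powr (- (d + real n))"
    using assms d2 by (intro powr_mono') auto
  also have "(1 - q) powr (- (d + real n)) = (1 - q) powi (- int CARD('d) - int n)"
  proof -
    have "(1 - q) powr (- (d + real n)) = inverse ((1 - q) ^ (CARD('d) + n))"
      using assms powr_realpow[of "1 - q" "CARD('d) + n"] unfolding powr_minus by (simp add: d_def)
    also have "\<dots> = (1 - q) powi (- int (CARD('d) + n))"
      by (simp only: power_int_minus power_int_of_nat)
    finally show ?thesis by simp
  qed
  finally have "cmod (mixed_deriv Ds (\<lambda>w \<eta>. f (klein_dirac_point w \<eta>)) z x) \<le>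
    coeff_norm * (Gamma (d / 2) * (\<Prod>i = 0..n. d / 2 + real i) * (1 - q) powi (- int CARD('d) - int n))"
    using coeff_norm_nonneg d2 by (simp add: mult_left_mono prod_nonneg)
  \<comment> \<open>The factor n in the claim is at least 1, so it only weakens a nonnegative
    bound.\<close>
  also have "\<dots> \<le> coeff_norm * (Gamma (d / 2) * (\<Prod>i = 0..n. d / 2 + real i) * (1 - q) powi (- int CARD('d) - int n)) * real n"
  proof -
    have "0 \<le> coeff_norm * (Gamma (d / 2) * (\<Prod>i = 0..n. d / 2 + real i) * (1 - q) powi (- int CARD('d) - int n))"
      using coeff_norm_nonneg d2 assms
      by (intro mult_nonneg_nonneg prod_nonneg) (auto intro: less_imp_le zero_le_power_int)
    from mult_left_mono[OF n1 this] show ?thesis by simp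
  qed
  finally show ?thesis by (simp only: n_def d_def mult_ac)
qed

end

section \<open>The maximum principle\<close>

theorem theorem21:
  fixes \<sigma> :: "(real ^ 'd::{finite,linorder}) measure"
    and Y :: "nat \<Rightarrow> nat \<Rightarrow> real ^ 'd::{finite,linorder} \<Rightarrow> complex"
  assumes "CARD('d) \<ge> 2"
    and "normalized_sphere_measure \<sigma>"
    and "orthonormal_harmonic_basis \<sigma> Y"
  shows "(\<forall>f\<in>hardy_space Y. \<forall>q::real. 0 < q \<longrightarrow> q < 1 \<longrightarrow>
            (\<forall>\<zeta> \<theta>. norm \<zeta> \<le> q \<longrightarrow> norm \<theta> = 1 \<longrightarrow>
               norm (f (klein_dirac_point \<zeta> \<theta>))
                 \<le> (1 - q) powi (- int CARD('d)) * hardy_norm Y f)) \<and>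
         (\<exists>C1::real. C1 > 0 \<and>
            (\<forall>f\<in>hardy_space Y. \<forall>q::real. 0 < q \<longrightarrow> q < 1 \<longrightarrow>
               (\<forall>Ds\<in>lists first_order_ops. length Ds \<ge> 1 \<longrightarrow>
                  (\<forall>\<zeta> \<theta>. norm \<zeta> \<le> q \<longrightarrow> norm \<theta> = 1 \<longrightarrow>
                     norm (mixed_deriv Ds (\<lambda>w \<eta>. f (klein_dirac_point w \<eta>)) \<zeta> \<theta>)
                       \<le> C1 * (1 - q) powi (- int CARD('d) - int (length Ds))
                           * (\<Prod>i = 0..length Ds. real CARD('d) / 2 + real i)
                           * real (length Ds) * hardy_norm Y f))))"
proof -
  \<comment> \<open>The coefficients chosen in \<open>hardy_norm\<close> do represent
    \<open>f\<close>, so the locale's norm becomes \<open>hardy_norm Y f\<close>.\<close>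
  have loc: "hardy_function \<sigma> Y f (SOME c. hardy_coeffs Y f c) (hardy_norm Y f)" if "f \<in> hardy_space Y" for f
    using assms that someI_ex[of "hardy_coeffs Y f"]
    by unfold_locales (auto simp: hardy_space_def hardy_norm_def)
  have ops: "Ds \<in> lists (insert zeta_deriv (range (\<lambda>(i, j). rot_deriv i j)))"
    if "Ds \<in> lists (first_order_ops :: ((complex \<Rightarrow> real ^ 'd::{finite,linorder} \<Rightarrow> complex) \<Rightarrow> complex \<Rightarrow> real ^ 'd::{finite,linorder} \<Rightarrow> complex) set)" for Ds
    using that by (rule rev_subsetD) (rule lists_mono, auto simp: first_order_ops_def)
  have "Gamma (real CARD('d) / 2) > 0" using assms(1) by (intro Gamma_real_pos) simp
  then show ?thesis
    using hardy_function.function_bound[OF loc] hardy_function.mixed_deriv_bound[OF loc ops]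
    by (intro conjI exI[of _ "Gamma (real CARD('d) / 2)"] ballI allI impI)
qed

end
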